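(* Let $n\ge 1$. Every $n$-sphere $S$ is homeomorphic to the minimal $n$-sphere $S^n_{min}$.
   Context: A digital space is a simple undirected graph with a finite or countable set of points (vertices). Subspaces are induced subgraphs; $H\subseteq G$ ("$H$ belongs to $G$") means $H$ is an induced subgraph of $G$. The rim $O(v)$ of a point $v$ is the subspace induced on the neighbors of $v$ (not containing $v$). $G-v$ is $G$ with the point $v$ deleted. The join $G\oplus H$ is the disjoint union of $G$ and $H$ with all edges between points of $G$ and points of $H$ added. Contractible graphs and contractible transformations: the one-point graph is contractible; the contractible transformations of a graph are (1) deleting a point $v$ with $O(v)$ contractible, (2) gluing a new point $v$ whose rim $O(v)$ is a contractible induced subgraph, (3) deleting an edge $(uv)$ with $O(u)\cap O(v)$ contractible, (4) adding an edge between non-adjacent points $u,v$ with $O(u)\cap O(v)$ contractible. A graph is contractible if it can be converted to a single point by a finite sequence of contractible transformations. Disks, spheres and manifolds are defined recursively. A 0-disk is a single point; a 0-sphere is the graph $S^0(a,b)$ with two non-adjacent points $a,b$. A 1-sphere is a finite connected graph in which the rim of each point is a 0-sphere. A 1-disk is a graph $S^1-v$ with $S^1$ a 1-sphere, $v\in S^1$. For $n\ge 1$: a closed $n$-manifold is a connected digital space in which the rim of every point is an $(n-1)$-sphere. An $n$-manifold with boundary is a connected space $N$ such that $N=M-v$ (up to isomorphism) for a closed $n$-manifold $M$ and a point $v\in M$; its boundary is $\partial N=O(v)$ and its interior is $\mathrm{Int}N=N-\partial N$. An $n$-disk is an $n$-manifold with boundary that is a contractible graph. For $n\ge 2$, an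 $n$-sphere is a graph $D\#C$ obtained from two $n$-disks $D,C$ with isomorphic boundaries by identifying each point of $\partial D$ with its counterpart in $\partial C$ under an isomorphism. The minimal $n$-sphere is the join $S^n_{min}=S^0_1\oplus S^0_2\oplus\dots\oplus S^0_{n+1}$ of $n+1$ copies of the 0-sphere. h-transformations of an $n$-manifold $N$: (a) for an $n$-disk $D$ belonging to $N$, replace $N$ by $N+v-\mathrm{Int}D$, obtained by adding a new point $v$ adjacent exactly to all points of $\partial D$ and deleting all points of $\mathrm{Int}D$; (b) for a point $v\in N$ and an $n$-disk $D$ (disjoint from $N$) with $\partial D$ isomorphic to $O(v)$, replace $N$ by $N-v+\mathrm{Int}D$, obtained by identifying each point of $\partial D$ with its counterpart in $O(v)$ under an isomorphism and deleting $v$. Closed $n$-manifolds are homeomorphic if one can be obtained from the other (up to isomorphism) by a finite sequence of h-transformations. *)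

theory Defs
  imports Main
begin

text \<open>
  Digital spaces have finitely or countably many points, so up to isomorphism their points are
  natural numbers. A space may occupy every natural number; therefore every construction below
  that needs fresh points or disjoint copies is taken up to isomorphism.
\<close>

datatype dgraph = DGraph (verts: "nat set") (edges: "nat set set")

definition digital_space :: "dgraph \<Rightarrow> bool" where
  "digital_space G \<longleftrightarrow> (\<forall>e\<in>edges G. e \<subseteq> verts G \<and> card e = 2)"

definition adj :: "dgraph \<Rightarrow> nat \<Rightarrow> nat \<Rightarrow> bool" where
  "adj G u v \<longleftrightarrow> {u, v} \<in> edges G"

definition nbrs :: "dgraph \<Rightarrow> nat \<Rightarrow> nat set" where
  "nbrs G v = {u \<in> verts G. adj G v u}"

definition induced :: "dgraph \<Rightarrow> nat set \<Rightarrow> dgraph" where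
  "induced G W = DGraph (verts G \<inter> W) {e \<in> edges G. e \<subseteq> W}"

definition rim :: "dgraph \<Rightarrow> nat \<Rightarrow> dgraph" where
  "rim G v = induced G (nbrs G v)"

definition delete_point :: "dgraph \<Rightarrow> nat \<Rightarrow> dgraph" where
  "delete_point G v = induced G (verts G - {v})"

definition add_point :: "dgraph \<Rightarrow> nat \<Rightarrow> nat set \<Rightarrow> dgraph" where
  "add_point G v B = DGraph (insert v (verts G)) (edges G \<union> {{v, x} | x. x \<in> B})"

definition delete_edge :: "dgraph \<Rightarrow> nat \<Rightarrow> nat \<Rightarrow> dgraph" where
  "delete_edge G u v = DGraph (verts G) (edges G - {{u, v}})"

definition add_edge :: "dgraph \<Rightarrow> nat \<Rightarrow> nat \<Rightarrow> dgraph" where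
  "add_edge G u v = DGraph (verts G) (insert {u, v} (edges G))"

definition dconnected :: "dgraph \<Rightarrow> bool" where
  "dconnected G \<longleftrightarrow> verts G \<noteq> {} \<and> (\<forall>u\<in>verts G. \<forall>v\<in>verts G. (adj G)\<^sup>*\<^sup>* u v)"

definition graph_iso :: "(nat \<Rightarrow> nat) \<Rightarrow> dgraph \<Rightarrow> dgraph \<Rightarrow> bool" where
  "graph_iso f G H \<longleftrightarrow> bij_betw f (verts G) (verts H) \<and>
     (\<forall>u\<in>verts G. \<forall>v\<in>verts G. adj G u v \<longleftrightarrow> adj H (f u) (f v))"

definition isomorphic :: "dgraph \<Rightarrow> dgraph \<Rightarrow> bool" where
  "isomorphic G H \<longleftrightarrow> (\<exists>f. graph_iso f G H)"

definition point_graph :: "nat \<Rightarrow> dgraph" where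
  "point_graph a = DGraph {a} {}"

definition S0 :: "nat \<Rightarrow> nat \<Rightarrow> dgraph" where
  "S0 a b = DGraph {a, b} {}"

text \<open>The join; only meaningful when the two vertex sets are disjoint.\<close>

definition join :: "dgraph \<Rightarrow> dgraph \<Rightarrow> dgraph" where
  "join G H = DGraph (verts G \<union> verts H)
     (edges G \<union> edges H \<union> {{u, v} | u v. u \<in> verts G \<and> v \<in> verts H})"

text \<open>
  For \<open>G\<close>, \<open>H\<close> with disjoint vertex sets and \<open>f\<close> injective on \<open>X \<subseteq> verts G\<close> with
  \<open>f ` X \<subseteq> verts H\<close>: the disjoint union of \<open>G\<close> and \<open>H\<close> in which every \<open>x \<in> X\<close> is identified with
  \<open>f x\<close>. The merged point keeps the name \<open>x\<close>.
\<close>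

definition identify :: "dgraph \<Rightarrow> nat set \<Rightarrow> (nat \<Rightarrow> nat) \<Rightarrow> dgraph \<Rightarrow> dgraph" where
  "identify G X f H =
     (let r = (\<lambda>y. if y \<in> f ` X then inv_into X f y else y)
      in DGraph (verts G \<union> r ` verts H) (edges G \<union> (\<lambda>e. r ` e) ` edges H))"

text \<open>
  Contractible transformations refer to contractibility of rims and contractibility refers to
  transformations; the two are the least pair of predicates closed under the rules.
\<close>

inductive contractible :: "dgraph \<Rightarrow> bool"
  and ctrans :: "dgraph \<Rightarrow> dgraph \<Rightarrow> bool"
where
  contractible_point: "contractible (point_graph a)"
| contractible_step: "ctrans G H \<Longrightarrow> contractible H \<Longrightarrow> contractible G"
| ctrans_delete_point:
    "digital_space G \<Longrightarrow> v \<in> verts G \<Longrightarrow> contractible (rim G v) \<Longrightarrow> ctrans G (delete_point G v)"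
| ctrans_add_point:
    "digital_space G \<Longrightarrow> v \<notin> verts G \<Longrightarrow> B \<subseteq> verts G \<Longrightarrow> contractible (induced G B) \<Longrightarrow>
     ctrans G (add_point G v B)"
| ctrans_delete_edge:
    "digital_space G \<Longrightarrow> adj G u v \<Longrightarrow> contractible (induced G (nbrs G u \<inter> nbrs G v)) \<Longrightarrow>
     ctrans G (delete_edge G u v)"
| ctrans_add_edge:
    "digital_space G \<Longrightarrow> u \<in> verts G \<Longrightarrow> v \<in> verts G \<Longrightarrow> u \<noteq> v \<Longrightarrow> \<not> adj G u v \<Longrightarrow>
     contractible (induced G (nbrs G u \<inter> nbrs G v)) \<Longrightarrow> ctrans G (add_edge G u v)"

text \<open>
  The recursive definition of spheres, manifolds and disks. \<open>manifold_bd n N B\<close> and \<open>disk n D B\<close>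
  carry the point set \<open>B\<close> of the boundary: \<open>\<partial>N = induced N B\<close> and
  \<open>Int N = induced N (verts N - B)\<close>. A 0-disk has empty boundary.
\<close>

inductive sphere :: "nat \<Rightarrow> dgraph \<Rightarrow> bool"
  and closed_manifold :: "nat \<Rightarrow> dgraph \<Rightarrow> bool"
  and manifold_bd :: "nat \<Rightarrow> dgraph \<Rightarrow> nat set \<Rightarrow> bool"
  and disk :: "nat \<Rightarrow> dgraph \<Rightarrow> nat set \<Rightarrow> bool"
where
  sphere_0: "a \<noteq> b \<Longrightarrow> sphere 0 (S0 a b)"
| sphere_1:
    "digital_space G \<Longrightarrow> finite (verts G) \<Longrightarrow> dconnected G \<Longrightarrow>
     (\<And>v. v \<in> verts G \<Longrightarrow> sphere 0 (rim G v)) \<Longrightarrow> sphere 1 G"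
| sphere_n:
    "n \<ge> 2 \<Longrightarrow> disk n D BD \<Longrightarrow> disk n C BC \<Longrightarrow> verts D \<inter> verts C = {} \<Longrightarrow>
     graph_iso f (induced D BD) (induced C BC) \<Longrightarrow>
     digital_space G \<Longrightarrow> isomorphic (identify D BD f C) G \<Longrightarrow> sphere n G"
| closed_manifold:
    "n \<ge> 1 \<Longrightarrow> digital_space M \<Longrightarrow> dconnected M \<Longrightarrow>
     (\<And>v. v \<in> verts M \<Longrightarrow> sphere (n - 1) (rim M v)) \<Longrightarrow> closed_manifold n M"
| manifold_bd:
    "closed_manifold n M \<Longrightarrow> v \<in> verts M \<Longrightarrow> digital_space N \<Longrightarrow> dconnected N \<Longrightarrow>
     graph_iso f (delete_point M v) N \<Longrightarrow> manifold_bd n N (f ` nbrs M v)"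
| disk_0: "disk 0 (point_graph a) {}"
| disk_1:
    "sphere 1 S \<Longrightarrow> v \<in> verts S \<Longrightarrow> digital_space D \<Longrightarrow>
     graph_iso f (delete_point S v) D \<Longrightarrow> disk 1 D (f ` nbrs S v)"
| disk_n: "n \<ge> 2 \<Longrightarrow> manifold_bd n D B \<Longrightarrow> contractible D \<Longrightarrow> disk n D B"

primrec min_sphere :: "nat \<Rightarrow> dgraph" where
  "min_sphere 0 = S0 0 1"
| "min_sphere (Suc n) = join (min_sphere n) (S0 (2 * n + 2) (2 * n + 3))"

inductive h_transformation :: "nat \<Rightarrow> dgraph \<Rightarrow> dgraph \<Rightarrow> bool" for n where
  shrink_disk:
    "closed_manifold n N \<Longrightarrow> W \<subseteq> verts N \<Longrightarrow> disk n (induced N W) B \<Longrightarrow> v \<notin> verts N \<Longrightarrow>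
     h_transformation n N
       (induced (add_point N v B) (insert v (verts N) - (W - B)))"
| expand_point:
    "closed_manifold n N \<Longrightarrow> v \<in> verts N \<Longrightarrow> disk n D B \<Longrightarrow> verts N \<inter> verts D = {} \<Longrightarrow>
     graph_iso f (rim N v) (induced D B) \<Longrightarrow>
     h_transformation n N (delete_point (identify N (nbrs N v) f D) v)"

definition h_reachable :: "nat \<Rightarrow> dgraph \<Rightarrow> dgraph \<Rightarrow> bool" where
  "h_reachable n = (\<lambda>M N. h_transformation n M N \<or> isomorphic M N)\<^sup>*\<^sup>*"

definition homeomorphic :: "nat \<Rightarrow> dgraph \<Rightarrow> dgraph \<Rightarrow> bool" where
  "homeomorphic n M N \<longleftrightarrow> closed_manifold n M \<and> closed_manifold n N \<and>
     (h_reachable n M N \<or> h_reachable n N M)"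

end

theory Submission
  imports Defs
begin

text \<open>
  If \<open>S\<close> is an \<open>n\<close>-sphere and \<open>u\<close> a point of it, then \<open>S - u\<close> is an \<open>n\<close>-disk with boundary \<open>O(u)\<close>;
  shrinking it to a point gives the suspension \<open>S\<^sup>0 \<oplus> O(u)\<close>, which is again an \<open>n\<close>-sphere. If two points
  of \<open>S\<close> are non-adjacent to each other but adjacent to everything else, then so they are after the
  step, while \<open>u\<close> joins the set of such points. So finitely many steps lead to an \<open>n\<close>-sphere in which
  every point has an antipode, and this is the minimal sphere.

  That \<open>S - u\<close> is contractible is shown by induction on \<open>n\<close>, together with the fact that \<open>S\<close> is a closed
  manifold. For adjacent \<open>u\<close>, \<open>v\<close> the rim of \<open>v\<close> in \<open>S - u\<close> is a punctured \<open>(n-1)\<close>-sphere, so both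
  \<open>S - u\<close> and \<open>S - v\<close> are equivalent to \<open>S - u - v\<close>; by connectedness it suffices to find one suitable
  point. If \<open>S = D # C\<close> and \<open>p\<close> lies in \<open>Int D\<close>, then \<open>S - p\<close> is equivalent to \<open>(D \<union> w) - p\<close>, with \<open>C\<close>
  shrunk to a point \<open>w\<close>, and \<open>(D \<union> w) - w = D\<close> is contractible.
\<close>

section \<open>Graphs and isomorphisms\<close>

lemma adj_commute: "adj G u v \<longleftrightarrow> adj G v u"
  by (simp add: adj_def insert_commute)

lemma adj_digital:
  assumes "digital_space G" "adj G u v"
  shows "u \<in> verts G" "v \<in> verts G" "u \<noteq> v"
  using assms unfolding digital_space_def adj_def by fastforce+

lemma adj_irrefl [simp]: "digital_space G \<Longrightarrow> \<not> adj G u u"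
  using adj_digital(3) by blast

lemma digital_edgeE:
  assumes "digital_space G" "e \<in> edges G"
  obtains u v where "e = {u, v}" "u \<noteq> v" "u \<in> verts G" "v \<in> verts G" "adj G u v"
proof -
  from assms have "e \<subseteq> verts G" "card e = 2" by (auto simp: digital_space_def)
  then obtain u v where "e = {u, v}" "u \<noteq> v" by (auto simp: card_2_iff)
  with assms \<open>e \<subseteq> verts G\<close> show ?thesis by (intro that) (auto simp: adj_def)
qed

lemma dgraph_eqI:
  assumes "digital_space G" "digital_space H" "verts G = verts H"
    and "\<And>u v. u \<in> verts G \<Longrightarrow> v \<in> verts G \<Longrightarrow> adj G u v \<longleftrightarrow> adj H u v"
  shows "G = H"
proof -
  have "e \<in> edges G \<longleftrightarrow> e \<in> edges H" for e
  proof
    assume "e \<in> edges G"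
    then show "e \<in> edges H"
      by (rule digital_edgeE[OF assms(1)]) (use assms(4) in \<open>auto simp: adj_def\<close>)
  next
    assume "e \<in> edges H"
    then show "e \<in> edges G"
      by (rule digital_edgeE[OF assms(2)]) (use assms(3,4) in \<open>auto simp: adj_def\<close>)
  qed
  then show ?thesis using assms(3) by (intro dgraph.expand) auto
qed

lemma digital_DGraph_empty [simp]: "digital_space (DGraph V {})"
  by (simp add: digital_space_def)

lemma verts_S0 [simp]: "verts (S0 a b) = {a, b}" and adj_S0 [simp]: "\<not> adj (S0 a b) x y"
  and digital_S0 [simp]: "digital_space (S0 a b)"
  by (auto simp: S0_def adj_def)

lemma verts_point_graph [simp]: "verts (point_graph a) = {a}"
  and adj_point_graph [simp]: "\<not> adj (point_graph a) x y"
  and digital_point_graph [simp]: "digital_space (point_graph a)"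
  by (auto simp: point_graph_def adj_def)

lemma verts_induced [simp]: "verts (induced G W) = verts G \<inter> W"
  by (simp add: induced_def)

lemma adj_induced [simp]: "adj (induced G W) u v \<longleftrightarrow> adj G u v \<and> u \<in> W \<and> v \<in> W"
  by (auto simp: induced_def adj_def)

lemma digital_induced [simp]: "digital_space G \<Longrightarrow> digital_space (induced G W)"
  by (auto simp: digital_space_def induced_def)

lemma mem_nbrs: "digital_space G \<Longrightarrow> u \<in> nbrs G v \<longleftrightarrow> adj G v u"
  using adj_digital by (auto simp: nbrs_def)

lemma nbrs_subset: "nbrs G v \<subseteq> verts G"
  by (auto simp: nbrs_def)

lemma nbrs_irrefl [simp]: "digital_space G \<Longrightarrow> v \<notin> nbrs G v"
  by (simp add: mem_nbrs)

lemma nbrs_induced: "digital_space G \<Longrightarrow> nbrs (induced G W) v = (if v \<in> W then nbrs G v \<inter> W else {})"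
  by (auto simp: mem_nbrs)

lemma verts_delete_point [simp]: "verts (delete_point G v) = verts G - {v}"
  by (auto simp: delete_point_def)

lemma adj_delete_point [simp]:
  "digital_space G \<Longrightarrow> adj (delete_point G v) x y \<longleftrightarrow> adj G x y \<and> x \<noteq> v \<and> y \<noteq> v"
  using adj_digital by (fastforce simp: delete_point_def)

lemma digital_delete_point [simp]: "digital_space G \<Longrightarrow> digital_space (delete_point G v)"
  by (simp add: delete_point_def)

lemma verts_rim [simp]: "verts (rim G v) = nbrs G v"
  using nbrs_subset by (auto simp: rim_def)

lemma adj_rim [simp]: "adj (rim G v) x y \<longleftrightarrow> adj G x y \<and> x \<in> nbrs G v \<and> y \<in> nbrs G v"
  by (auto simp: rim_def)

lemma digital_rim [simp]: "digital_space G \<Longrightarrow> digital_space (rim G v)"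
  by (simp add: rim_def)

lemma verts_add_point [simp]: "verts (add_point G v B) = insert v (verts G)"
  by (simp add: add_point_def)

lemma adj_add_point [simp]:
  "adj (add_point G v B) x y \<longleftrightarrow> adj G x y \<or> x = v \<and> y \<in> B \<or> y = v \<and> x \<in> B"
  by (auto simp: add_point_def adj_def doubleton_eq_iff)

lemma digital_add_point [simp]:
  "digital_space G \<Longrightarrow> v \<notin> verts G \<Longrightarrow> B \<subseteq> verts G \<Longrightarrow> digital_space (add_point G v B)"
  by (fastforce simp: add_point_def digital_space_def card_insert_if)

lemma delete_add_point:
  assumes "digital_space G" "v \<notin> verts G" "B \<subseteq> verts G"
  shows "delete_point (add_point G v B) v = G"
  using assms by (intro dgraph_eqI) auto

lemma add_delete_point:
  assumes "digital_space G" "v \<in> verts G"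
  shows "add_point (delete_point G v) v (nbrs G v) = G"
proof (rule dgraph_eqI)
  show "digital_space (add_point (delete_point G v) v (nbrs G v))"
    using assms by (intro digital_add_point) (auto simp: mem_nbrs adj_digital)
qed (use assms in \<open>auto simp: mem_nbrs adj_commute\<close>)

lemma nbrs_add_point:
  assumes "digital_space G" "v \<notin> verts G" "B \<subseteq> verts G"
  shows "nbrs (add_point G v B) v = B"
    and "x \<in> verts G \<Longrightarrow> nbrs (add_point G v B) x = (if x \<in> B then insert v (nbrs G x) else nbrs G x)"
  using assms adj_digital by (auto simp: mem_nbrs)

lemma graph_isoD:
  assumes "graph_iso f G H"
  shows "bij_betw f (verts G) (verts H)" "inj_on f (verts G)" "f ` verts G = verts H"
    and "\<And>u v. u \<in> verts G \<Longrightarrow> v \<in> verts G \<Longrightarrow> adj H (f u) (f v) \<longleftrightarrow> adj G u v"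
    and "\<And>u. u \<in> verts G \<Longrightarrow> f u \<in> verts H"
  using assms by (auto simp: graph_iso_def bij_betw_def)

lemma graph_iso_id [simp]: "graph_iso id G G" "graph_iso (\<lambda>x. x) G G"
  by (auto simp: graph_iso_def bij_betw_def)

lemma graph_iso_inv:
  assumes "graph_iso f G H"
  shows "graph_iso (inv_into (verts G) f) H G"
proof -
  have b: "bij_betw f (verts G) (verts H)" using assms by (rule graph_isoD)
  show ?thesis unfolding graph_iso_def
  proof (intro conjI ballI)
    fix x y assume xy: "x \<in> verts H" "y \<in> verts H"
    have "inv_into (verts G) f x \<in> verts G" "inv_into (verts G) f y \<in> verts G"
      using xy bij_betw_inv_into[OF b] by (auto dest: bij_betwE)
    from graph_isoD(4)[OF assms this] xy
    show "adj H x y \<longleftrightarrow> adj G (inv_into (verts G) f x) (inv_into (verts G) f y)"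
      by (simp add: bij_betw_inv_into_right[OF b])
  qed (rule bij_betw_inv_into[OF b])
qed

lemma graph_iso_comp:
  assumes "graph_iso f G H" "graph_iso g H K"
  shows "graph_iso (g \<circ> f) G K"
  using assms unfolding graph_iso_def by (auto intro: bij_betw_trans dest: bij_betwE)

lemma isomorphic_trans: "isomorphic G H \<Longrightarrow> isomorphic H K \<Longrightarrow> isomorphic G K"
  unfolding isomorphic_def using graph_iso_comp by blast

lemma graph_iso_induced:
  assumes "graph_iso f G H" "W \<subseteq> verts G"
  shows "graph_iso f (induced G W) (induced H (f ` W))"
  using assms unfolding graph_iso_def by (auto simp: bij_betw_def inj_on_def)

lemma graph_iso_nbrs:
  assumes "graph_iso f G H" "v \<in> verts G"
  shows "f ` nbrs G v = nbrs H (f v)"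
proof -
  have "y \<in> nbrs H (f v) \<Longrightarrow> y \<in> f ` nbrs G v" for y
  proof -
    assume y: "y \<in> nbrs H (f v)"
    then obtain x where "x \<in> verts G" "y = f x"
      using graph_isoD(3)[OF assms(1)] nbrs_subset by blast
    with y show ?thesis
      using graph_isoD(4)[OF assms(1)] assms(2) by (auto simp: nbrs_def)
  qed
  then show ?thesis
    using graph_isoD[OF assms(1)] assms(2) by (auto simp: nbrs_def)
qed

lemma graph_iso_rim:
  assumes "graph_iso f G H" "v \<in> verts G"
  shows "graph_iso f (rim G v) (rim H (f v))"
  using graph_iso_induced[OF assms(1) nbrs_subset[of G v]] graph_iso_nbrs[OF assms] by (simp add: rim_def)

lemma graph_iso_add_point:
  assumes "graph_iso f (delete_point M v) N" "digital_space M" "digital_space N" "v \<in> verts M"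
    "w \<notin> verts N"
  shows "graph_iso (f(v := w)) M (add_point N w (f ` nbrs M v))"
proof -
  note f = graph_isoD[OF assms(1)]
  have 1: "bij_betw (f(v := w)) (verts M) (insert w (verts N))"
    using f(2,3) assms(4,5) by (auto simp: bij_betw_def inj_on_def image_iff)
  have 2: "f x \<noteq> w" if "x \<in> verts M" "x \<noteq> v" for x
    using f(5)[of x] that assms(5) by auto
  have 3: "f x \<in> f ` nbrs M v \<longleftrightarrow> adj M v x" if "x \<in> verts M" "x \<noteq> v" for x
  proof
    assume "f x \<in> f ` nbrs M v"
    then obtain y where y: "y \<in> nbrs M v" "f x = f y" by auto
    then have "y \<in> verts M" "y \<noteq> v" using assms(2) nbrs_subset by auto
    with y that f(2) have "x = y" by (auto simp: inj_on_def)
    with y assms(2) show "adj M v x" by (simp add: mem_nbrs)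
  qed (use assms(2) in \<open>auto simp: mem_nbrs\<close>)
  have 4: "\<not> adj N w x" "\<not> adj N x w" for x
    using assms(3,5) adj_digital by blast+
  have 5: "w \<notin> f ` nbrs M v"
    using 2 assms(2) nbrs_subset by (metis imageE nbrs_irrefl subsetD)
  show ?thesis unfolding graph_iso_def
  proof (intro conjI ballI)
    show "bij_betw (f(v := w)) (verts M) (verts (add_point N w (f ` nbrs M v)))" using 1 by simp
  next
    fix x y assume xy: "x \<in> verts M" "y \<in> verts M"
    show "adj M x y \<longleftrightarrow> adj (add_point N w (f ` nbrs M v)) ((f(v := w)) x) ((f(v := w)) y)"
      using f(4)[of x y] xy 2 3 4 5 assms(2) adj_commute[of M x v] by auto
  qed
qed

lemma connected_reach:
  assumes "a \<in> verts G" "\<And>x. x \<in> verts G \<Longrightarrow> (adj G)\<^sup>*\<^sup>* a x"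
  shows "dconnected G"
proof -
  have "symp (adj G)\<^sup>*\<^sup>*" by (intro symp_rtranclp) (simp add: symp_def adj_commute)
  then have "(adj G)\<^sup>*\<^sup>* u v" if "u \<in> verts G" "v \<in> verts G" for u v
    by (meson that assms(2) sympD rtranclp_trans)
  then show ?thesis using assms(1) by (auto simp: dconnected_def)
qed

lemma dconnected_iso:
  assumes "dconnected G" "graph_iso f G H" "digital_space G"
  shows "dconnected H"
proof -
  note f = graph_isoD[OF assms(2)]
  have path: "(adj H)\<^sup>*\<^sup>* (f u) (f v)" if "(adj G)\<^sup>*\<^sup>* u v" for u v
    using that
  proof induction
    case (step y z)
    then have "adj H (f y) (f z)" by (simp add: f(4) adj_digital(1,2)[OF assms(3) step(2)])
    with step show ?case by simp
  qed simp
  obtain a where a: "a \<in> verts G" using assms(1) by (auto simp: dconnected_def)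
  show ?thesis
  proof (rule connected_reach[of "f a"])
    fix y assume "y \<in> verts H"
    then obtain x where "x \<in> verts G" "y = f x" using f(3) by blast
    with a path assms(1) show "(adj H)\<^sup>*\<^sup>* (f a) y" by (simp add: dconnected_def)
  qed (use a f(5) in simp)
qed

lemma induced_verts: "digital_space G \<Longrightarrow> verts G \<subseteq> W \<Longrightarrow> induced G W = G"
  by (rule dgraph_eqI) (auto dest: adj_digital)

lemma induced_induced: "induced (induced G A) B = induced G (A \<inter> B)"
  by (auto simp: induced_def)

lemma dconnected_delete_point_reach:
  assumes "digital_space G" "dconnected G" "a \<in> nbrs G v"
    and rim: "\<And>b. b \<in> nbrs G v \<Longrightarrow> (adj (delete_point G v))\<^sup>*\<^sup>* a b"
  shows "dconnected (delete_point G v)"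
proof -
  let ?H = "delete_point G v"
  have av: "a \<noteq> v" "a \<in> verts G" using assms(1,3) nbrs_subset by auto
  have "x \<noteq> v \<longrightarrow> (adj ?H)\<^sup>*\<^sup>* a x" if "(adj G)\<^sup>*\<^sup>* a x" for x
    using that
  proof induction
    case (step y z)
    show ?case
    proof (cases "y = v")
      case True
      with step show ?thesis using rim[of z] mem_nbrs[OF assms(1)] by blast
    next
      case False
      show ?thesis
      proof
        assume "z \<noteq> v"
        with step(2) False assms(1) have "adj ?H y z" by simp
        with step(3) False show "(adj ?H)\<^sup>*\<^sup>* a z" by (blast intro: rtranclp.rtrancl_into_rtrancl)
      qed
    qed
  qed simp
  then show ?thesis
    using assms(2) av by (intro connected_reach[of a]) (auto simp: dconnected_def)
qed

lemma dconnected_delete_point: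
  assumes "digital_space G" "dconnected G" "dconnected (rim G v)"
  shows "dconnected (delete_point G v)"
proof -
  obtain a where a: "a \<in> nbrs G v" using assms(3) by (auto simp: dconnected_def)
  show ?thesis
  proof (rule dconnected_delete_point_reach[OF assms(1,2) a])
    fix b assume "b \<in> nbrs G v"
    with a assms(3) have "(adj (rim G v))\<^sup>*\<^sup>* a b" by (auto simp: dconnected_def)
    then show "(adj (delete_point G v))\<^sup>*\<^sup>* a b"
      by (rule rtranclp_mono[THEN predicate2D, rotated]) (use assms(1) in auto)
  qed
qed

lemma dconnected_union:
  assumes "verts G = W1 \<union> W2" "dconnected (induced G W1)" "dconnected (induced G W2)" "a \<in> W1 \<inter> W2"
  shows "dconnected G"
proof (rule connected_reach[of a])
  fix x assume x: "x \<in> verts G"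
  have "(adj (induced G W1))\<^sup>*\<^sup>* a x \<or> (adj (induced G W2))\<^sup>*\<^sup>* a x"
    using x assms(1,4) assms(2,3)[unfolded dconnected_def] by force
  moreover have "(adj G)\<^sup>*\<^sup>* a x" if "(adj (induced G W))\<^sup>*\<^sup>* a x" for W
    using that by (rule rtranclp_mono[THEN predicate2D, rotated]) auto
  ultimately show "(adj G)\<^sup>*\<^sup>* a x" by auto
qed (use assms in auto)

lemma dconnected_cone:
  assumes "v \<in> verts G" "\<And>x. x \<in> verts G \<Longrightarrow> x \<noteq> v \<Longrightarrow> adj G v x"
  shows "dconnected G"
  by (rule connected_reach[OF assms(1)]) (use assms(2) in blast)

section \<open>Contractible graphs\<close>

lemma contractible_digital: "contractible G \<Longrightarrow> digital_space G"
  and ctrans_digital: "ctrans G H \<Longrightarrow> digital_space G"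
  by (induction rule: contractible_ctrans.inducts) auto

lemma contractible_finite: "contractible G \<Longrightarrow> finite (verts G)"
  and ctrans_finite: "ctrans G H \<Longrightarrow> finite (verts G) \<longleftrightarrow> finite (verts H)"
  by (induction rule: contractible_ctrans.inducts) (auto simp: delete_edge_def add_edge_def)

lemma contractible_delete_point_iff:
  assumes "digital_space G" "v \<in> verts G" "contractible (rim G v)"
  shows "contractible (delete_point G v) \<longleftrightarrow> contractible G"
proof
  assume "contractible (delete_point G v)"
  then show "contractible G"
    using ctrans_delete_point[OF assms] contractible_step by blast
next
  have sub: "nbrs G v \<subseteq> verts (delete_point G v)" using assms(1) nbrs_subset by auto
  have "induced (delete_point G v) (nbrs G v) = rim G v"
    using assms(1) sub by (intro dgraph_eqI) auto
  then have "ctrans (delete_point G v) (add_point (delete_point G v) v (nbrs G v))"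
    using assms sub by (intro ctrans_add_point) auto
  then have "ctrans (delete_point G v) G"
    using add_delete_point[OF assms(1,2)] by simp
  moreover assume "contractible G"
  ultimately show "contractible (delete_point G v)" by (rule contractible_step)
qed

lemma cone_contractible:
  assumes "finite (verts G)" "digital_space G" "v \<in> verts G"
    "\<And>x. x \<in> verts G \<Longrightarrow> x \<noteq> v \<Longrightarrow> adj G v x"
  shows "contractible G"
  using assms
proof (induction "card (verts G)" arbitrary: G rule: less_induct)
  case less
  show ?case
  proof (cases "verts G = {v}")
    case True
    with less.prems(2) have "G = point_graph v" by (intro dgraph_eqI) auto
    then show ?thesis by (simp add: contractible_point)
  next
    case False
    with less.prems(3) obtain x where x: "x \<in> verts G" "x \<noteq> v" by auto
    have "nbrs G x \<subset> verts G" using nbrs_irrefl[OF less.prems(2)] nbrs_subset x by blast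
    then have "card (verts (rim G x)) < card (verts G)"
      by (simp add: less.prems(1) psubset_card_mono)
    moreover have "adj G x v" using less.prems(4) x adj_commute by blast
    ultimately have "contractible (rim G x)"
      using less.prems x by (intro less.hyps) (auto simp: mem_nbrs adj_digital intro: finite_subset[OF nbrs_subset])
    moreover have "contractible (delete_point G x)"
      using less.prems x by (intro less.hyps) (auto simp del: card_Diff_insert intro: card_Diff1_less)
    ultimately show ?thesis
      using contractible_delete_point_iff less.prems(2) x(1) by blast
  qed
qed

definition rename :: "(nat \<Rightarrow> nat) \<Rightarrow> dgraph \<Rightarrow> dgraph" where
  "rename f G = DGraph (f ` verts G) ((\<lambda>e. f ` e) ` edges G)"

lemma verts_rename [simp]: "verts (rename f G) = f ` verts G"
  by (simp add: rename_def)

lemma digital_rename: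
  assumes "digital_space G" "inj_on f (verts G)"
  shows "digital_space (rename f G)"
  using assms unfolding digital_space_def rename_def
  by (auto simp: card_image inj_on_subset)

lemma graph_iso_rename:
  assumes "digital_space G" "inj_on f (verts G)"
  shows "graph_iso f G (rename f G)"
proof -
  have "adj G u v" if uv: "u \<in> verts G" "v \<in> verts G" "adj (rename f G) (f u) (f v)" for u v
  proof -
    from uv obtain e where e: "e \<in> edges G" "f ` {u, v} = f ` e" by (auto simp: rename_def adj_def)
    then have "e \<subseteq> verts G" "{u, v} \<subseteq> verts G" using assms(1) uv by (auto simp: digital_space_def)
    then have "{u, v} = e" using assms(2) e(2) inj_on_image_eq_iff by blast
    with e show ?thesis by (simp add: adj_def)
  qed
  moreover have "adj (rename f G) (f u) (f v)" if "adj G u v" for u v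
    using that by (auto simp: rename_def adj_def intro!: image_eqI[of _ _ "{u, v}"])
  ultimately show ?thesis using assms by (auto simp: graph_iso_def bij_betw_def)
qed

lemma graph_iso_eq_rename:
  assumes "graph_iso f G H" "digital_space G" "digital_space H"
  shows "H = rename f G"
proof -
  have r: "graph_iso f G (rename f G)"
    using assms graph_iso_rename graph_isoD(2) by blast
  show ?thesis
  proof (rule dgraph_eqI)
    show "digital_space (rename f G)" using digital_rename assms graph_isoD(2) by blast
    show "verts H = verts (rename f G)" using graph_isoD(3)[OF assms(1)] by simp
    fix u v assume "u \<in> verts H" "v \<in> verts H"
    then obtain x y where "x \<in> verts G" "y \<in> verts G" "u = f x" "v = f y"
      using graph_isoD(3)[OF assms(1)] by blast
    then show "adj H u v \<longleftrightarrow> adj (rename f G) u v"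
      using graph_isoD(4)[OF assms(1)] graph_isoD(4)[OF r] by simp
  qed (use assms in auto)
qed

lemma adj_rename [simp]: "inj f \<Longrightarrow> adj (rename f G) (f u) (f v) \<longleftrightarrow> adj G u v"
proof -
  assume "inj f"
  moreover have "{f u, f v} = f ` {u, v}" by simp
  ultimately show ?thesis unfolding adj_def rename_def
    by (metis (no_types) dgraph.sel(2) image_eqI imageE inj_image_eq_iff)
qed

lemma nbrs_rename: "inj f \<Longrightarrow> nbrs (rename f G) (f v) = f ` nbrs G v"
  by (auto simp: nbrs_def)

lemma rename_induced: "inj f \<Longrightarrow> rename f (induced G W) = induced (rename f G) (f ` W)"
  by (auto simp: rename_def induced_def image_Int inj_image_subset_iff)

lemma rename_delete_point: "inj f \<Longrightarrow> rename f (delete_point G v) = delete_point (rename f G) (f v)"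
  by (simp add: delete_point_def rename_induced image_set_diff)

lemma rename_add_point: "rename f (add_point G v B) = add_point (rename f G) (f v) (f ` B)"
proof -
  have "(\<lambda>e. f ` e) ` {{v, x} | x. x \<in> B} = {{f v, y} | y. y \<in> f ` B}"
    by (simp add: Setcompr_eq_image image_image)
  then show ?thesis by (simp add: rename_def add_point_def image_Un)
qed

lemma rename_delete_edge: "inj f \<Longrightarrow> rename f (delete_edge G u v) = delete_edge (rename f G) (f u) (f v)"
  using inj_image_eq_iff[of f _ "{u, v}"] by (auto simp: rename_def delete_edge_def)

lemma rename_add_edge: "rename f (add_edge G u v) = add_edge (rename f G) (f u) (f v)"
  by (simp add: rename_def add_edge_def)

lemma contractible_rename: "contractible G \<Longrightarrow> inj f \<Longrightarrow> contractible (rename f G)"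
  and ctrans_rename: "ctrans G H \<Longrightarrow> inj f \<Longrightarrow> ctrans (rename f G) (rename f H)"
proof (induction rule: contractible_ctrans.inducts)
  case (contractible_point a)
  have "rename f (point_graph a) = point_graph (f a)" by (simp add: rename_def point_graph_def)
  then show ?case by (simp add: contractible_ctrans.contractible_point)
next
  case (contractible_step G H)
  show ?case
    using contractible_step.IH[OF contractible_step.prems] by (rule contractible_ctrans.contractible_step)
next
  case (ctrans_delete_point G v)
  show ?case
    unfolding rename_delete_point[OF ctrans_delete_point.prems]
    using ctrans_delete_point
    by (intro contractible_ctrans.ctrans_delete_point digital_rename inj_on_subset[OF ctrans_delete_point.prems])
      (simp_all add: rename_induced rim_def nbrs_rename)
next
  case (ctrans_add_point G v B)
  show ?case
    unfolding rename_add_point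
    using ctrans_add_point
    by (intro contractible_ctrans.ctrans_add_point digital_rename inj_on_subset[OF ctrans_add_point.prems])
      (simp_all add: rename_induced inj_image_mem_iff image_mono)
next
  case (ctrans_delete_edge G u v)
  show ?case
    unfolding rename_delete_edge[OF ctrans_delete_edge.prems]
    using ctrans_delete_edge
    by (intro contractible_ctrans.ctrans_delete_edge digital_rename inj_on_subset[OF ctrans_delete_edge.prems])
      (simp_all add: rename_induced nbrs_rename flip: image_Int)
next
  case (ctrans_add_edge G u v)
  show ?case
    unfolding rename_add_edge
    using ctrans_add_edge
    by (intro contractible_ctrans.ctrans_add_edge digital_rename inj_on_subset[OF ctrans_add_edge.prems])
      (simp_all add: rename_induced nbrs_rename inj_eq flip: image_Int)
qed

lemma bij_extend:
  fixes A B :: "'a set"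
  assumes "bij_betw f A B" "finite A"
  obtains p where "bij p" "\<And>x. x \<in> A \<Longrightarrow> p x = f x"
proof -
  have fin: "finite B" "card A = card B"
    using assms bij_betw_finite bij_betw_same_card by blast+
  have "card (B - A) = card (A - B)"
    using assms(2) fin by (metis card_Diff_subset_Int finite_Int inf_commute)
  then obtain g where g: "bij_betw g (B - A) (A - B)"
    using assms(2) fin finite_same_card_bij by blast
  define p where "p x = (if x \<in> A then f x else if x \<in> B then g x else x)" for x
  have "bij_betw p A B" using assms(1) by (subst bij_betw_cong[of _ _ f]) (auto simp: p_def)
  moreover have "bij_betw p (B - A) (A - B)"
    using g by (subst bij_betw_cong[of _ _ g]) (auto simp: p_def)
  moreover have "bij_betw p (- (A \<union> B)) (- (A \<union> B))"
    by (subst bij_betw_cong[of _ _ id]) (auto simp: p_def)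
  ultimately have "bij_betw p (A \<union> (B - A) \<union> - (A \<union> B)) (B \<union> (A - B) \<union> - (A \<union> B))"
    by (intro bij_betw_combine) auto
  moreover have "A \<union> (B - A) \<union> - (A \<union> B) = UNIV" "B \<union> (A - B) \<union> - (A \<union> B) = UNIV" by auto
  ultimately have "bij p" by simp
  then show ?thesis by (rule that) (simp add: p_def)
qed

lemma contractible_iso:
  assumes "contractible G" "graph_iso f G H" "digital_space H"
  shows "contractible H"
proof -
  have G: "digital_space G" "finite (verts G)"
    using assms(1) contractible_digital contractible_finite by auto
  obtain p where p: "bij p" "\<And>x. x \<in> verts G \<Longrightarrow> p x = f x"
    using bij_extend[OF graph_isoD(1)[OF assms(2)] G(2)] by metis
  have "graph_iso p G H" using assms(2) p(2) bij_betw_cong[of "verts G" p f]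
    by (simp add: graph_iso_def)
  then have "H = rename p G" using graph_iso_eq_rename G(1) assms(3) by blast
  then show ?thesis using contractible_rename[OF assms(1)] p(1) by (simp add: bij_is_inj)
qed

section \<open>Spheres, manifolds and disks\<close>

lemma sphere_digital: "sphere n G \<Longrightarrow> digital_space G"
  by (erule sphere.cases) auto

lemma closed_manifold_iff:
  "closed_manifold n M \<longleftrightarrow> n \<ge> 1 \<and> digital_space M \<and> dconnected M \<and>
     (\<forall>v\<in>verts M. sphere (n - 1) (rim M v))"
  by (auto intro: closed_manifold elim: closed_manifold.cases)

lemma sphere_0_iff:
  "sphere 0 G \<longleftrightarrow> digital_space G \<and> (\<exists>a b. a \<noteq> b \<and> verts G = {a, b} \<and> \<not> adj G a b)"
proof safe
  fix a b assume "digital_space G" "a \<noteq> b" "verts G = {a, b}" "\<not> adj G a b"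
  then have "G = S0 a b" using adj_commute[of G a b] by (intro dgraph_eqI) auto
  with \<open>a \<noteq> b\<close> show "sphere 0 G" by (simp add: sphere_0)
next
  assume "sphere 0 G"
  then show "\<exists>a b. a \<noteq> b \<and> verts G = {a, b} \<and> \<not> adj G a b"
    by (cases rule: sphere.cases) auto
qed (rule sphere_digital)

lemma sphere_1_iff:
  "sphere (Suc 0) G \<longleftrightarrow> digital_space G \<and> finite (verts G) \<and> dconnected G \<and>
     (\<forall>v\<in>verts G. sphere 0 (rim G v))"
proof
  assume "sphere (Suc 0) G"
  then show "digital_space G \<and> finite (verts G) \<and> dconnected G \<and> (\<forall>v\<in>verts G. sphere 0 (rim G v))"
    by (cases rule: sphere.cases) auto
qed (use sphere_1[of G] in simp)

lemma sphere_iso: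
  assumes "sphere n G" "graph_iso f G H" "digital_space H"
  shows "sphere n H"
proof -
  note f = graph_isoD[OF assms(2)]
  have 0: "sphere 0 K" if "sphere 0 J" "graph_iso g J K" "digital_space K" for g J K
  proof -
    note g = graph_isoD[OF that(2)]
    from that(1) obtain a b where ab: "a \<noteq> b" "verts J = {a, b}" "\<not> adj J a b"
      by (auto simp: sphere_0_iff)
    then have "g a \<noteq> g b" "verts K = {g a, g b}" "\<not> adj K (g a) (g b)"
      using g(2,3,4) by (auto simp: inj_on_def)
    with that(3) show ?thesis by (auto simp: sphere_0_iff)
  qed
  consider "n = 0" | "n = Suc 0" | "n \<ge> 2" by linarith
  then show ?thesis
  proof cases
    case 1
    with assms 0 show ?thesis by blast
  next
    case 2
    with assms(1) have G: "digital_space G" "finite (verts G)" "dconnected G"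
      "\<And>v. v \<in> verts G \<Longrightarrow> sphere 0 (rim G v)" by (auto simp: sphere_1_iff)
    have "sphere 0 (rim H y)" if "y \<in> verts H" for y
    proof -
      from that obtain x where "x \<in> verts G" "y = f x" using f(3) by blast
      then show ?thesis
        using 0[OF G(4) graph_iso_rim[OF assms(2)] digital_rim[OF assms(3)]] by simp
    qed
    moreover have "finite (verts H)" using G(2) f(3) by (metis finite_imageI)
    ultimately show ?thesis
      using 2 assms(3) dconnected_iso[OF G(3) assms(2) G(1)] by (simp add: sphere_1_iff)
  next
    case 3
    from assms(1) show ?thesis
    proof cases
      case (sphere_n D BD C BC g)
      moreover have "isomorphic (identify D BD g C) H"
        using isomorphic_trans sphere_n(7) assms(2) isomorphic_def by blast
      ultimately show ?thesis using assms(3) by (intro sphere_closed_manifold_manifold_bd_disk.sphere_n)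
    qed (use 3 in auto)
  qed
qed

lemma closed_manifold_iso:
  assumes "closed_manifold n M" "graph_iso f M N" "digital_space N"
  shows "closed_manifold n N"
proof -
  note f = graph_isoD[OF assms(2)]
  have "sphere (n - 1) (rim N y)" if "y \<in> verts N" for y
  proof -
    from that obtain x where "x \<in> verts M" "y = f x" using f(3) by blast
    then show ?thesis
      using sphere_iso[OF _ graph_iso_rim[OF assms(2)] digital_rim[OF assms(3)]] assms(1)
      by (simp add: closed_manifold_iff)
  qed
  moreover have "dconnected N"
    using assms(1) dconnected_iso[OF _ assms(2)] by (simp add: closed_manifold_iff)
  ultimately show ?thesis using assms by (simp add: closed_manifold_iff)
qed

lemma disk_0_iff: "disk 0 D B \<longleftrightarrow> (\<exists>a. D = point_graph a) \<and> B = {}"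
  by (auto intro: disk_0 elim: disk.cases)

lemma disk_1_iff:
  "disk (Suc 0) D B \<longleftrightarrow> (\<exists>S v f. sphere (Suc 0) S \<and> v \<in> verts S \<and> digital_space D \<and>
     graph_iso f (delete_point S v) D \<and> B = f ` nbrs S v)"
  (is "?L \<longleftrightarrow> ?R")
proof
  assume ?L
  then show ?R by cases auto
qed (use disk_1 in force)

lemma manifold_bd_iff:
  "manifold_bd n D B \<longleftrightarrow> (\<exists>M v f. closed_manifold n M \<and> v \<in> verts M \<and> digital_space D \<and>
     dconnected D \<and> graph_iso f (delete_point M v) D \<and> B = f ` nbrs M v)"
  (is "?L \<longleftrightarrow> ?R")
proof
  assume ?L
  then show ?R by cases blast
qed (blast intro: manifold_bd)

lemma disk_n_iff: "n \<ge> 2 \<Longrightarrow> disk n D B \<longleftrightarrow> manifold_bd n D B \<and> contractible D"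
  by (auto intro: disk_n elim: disk.cases)

lemma disk_iso:
  assumes "disk n D B" "graph_iso g D E" "digital_space E"
  shows "disk n E (g ` B)"
proof -
  consider "n = 0" | "n = Suc 0" | "n \<ge> 2" by linarith
  then show ?thesis
  proof cases
    case 1
    with assms(1) obtain a where "D = point_graph a" "B = {}" by (auto simp: disk_0_iff)
    moreover from this have "verts E = {g a}" using graph_isoD(3)[OF assms(2)] by auto
    then have "E = point_graph (g a)" using assms(3) by (intro dgraph_eqI) auto
    ultimately show ?thesis using 1 by (simp add: disk_0)
  next
    case 2
    with assms(1) obtain S v f where "sphere (Suc 0) S" "v \<in> verts S"
      "graph_iso f (delete_point S v) D" "B = f ` nbrs S v" by (auto simp: disk_1_iff)
    moreover from this have "graph_iso (g \<circ> f) (delete_point S v) E"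
      using assms(2) graph_iso_comp by blast
    ultimately show ?thesis using disk_1[of S v E "g \<circ> f"] 2 assms(3) by (simp add: image_comp)
  next
    case 3
    with assms(1) obtain M v f where D: "contractible D" "dconnected D" "digital_space D"
      and M: "closed_manifold n M" "v \<in> verts M" "graph_iso f (delete_point M v) D" "B = f ` nbrs M v"
      by (auto simp: disk_n_iff manifold_bd_iff)
    from M have "graph_iso (g \<circ> f) (delete_point M v) E"
      using assms(2) graph_iso_comp by blast
    moreover have "dconnected E" using dconnected_iso[OF D(2) assms(2) D(3)] .
    ultimately have "manifold_bd n E (g ` B)"
      using manifold_bd[of n M v E "g \<circ> f"] M assms(3) by (simp add: image_comp)
    moreover have "contractible E" using contractible_iso[OF D(1) assms(2,3)] .
    ultimately show ?thesis using 3 by (simp add: disk_n_iff)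
  qed
qed

lemma disk_digital:
  assumes "disk n D B"
  shows "digital_space D"
  using assms
proof cases
  case disk_n
  then show ?thesis by (simp add: contractible_digital)
qed simp_all

lemma disk_finite:
  assumes "disk n D B"
  shows "finite (verts D)"
  using assms
proof cases
  case (disk_1 S v f)
  then have "verts D = f ` (verts S - {v})" "finite (verts S)"
    using graph_isoD(3)[of f "delete_point S v" D] by (auto simp: sphere_1_iff)
  then show ?thesis by simp
next
  case disk_n
  then show ?thesis using contractible_finite by blast
qed simp

lemma disk_boundary_subset:
  assumes "disk n D B"
  shows "B \<subseteq> verts D"
proof -
  have "f ` nbrs M v \<subseteq> verts D" if "graph_iso f (delete_point M v) D" "digital_space M" for f M v
  proof -
    have "nbrs M v \<subseteq> verts (delete_point M v)" using that(2) nbrs_subset by auto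
    then show ?thesis using graph_isoD(3)[OF that(1)] by blast
  qed
  note * = this
  from assms show ?thesis
  proof cases
    case (disk_1 S v f)
    then show ?thesis using *[of f S v] sphere_digital by simp
  next
    case disk_n
    then obtain M v f where "closed_manifold n M" "graph_iso f (delete_point M v) D" "B = f ` nbrs M v"
      by (auto simp: manifold_bd_iff)
    then show ?thesis using * by (simp add: closed_manifold_iff)
  qed simp
qed

section \<open>Gluing along a common boundary\<close>

definition glued :: "dgraph \<Rightarrow> nat set \<Rightarrow> nat set \<Rightarrow> bool" where
  "glued G W1 W2 \<longleftrightarrow> digital_space G \<and> verts G = W1 \<union> W2 \<and>
     (\<forall>x\<in>W1 - W2. \<forall>y\<in>W2 - W1. \<not> adj G x y)"

lemma glued_commute: "glued G W1 W2 \<longleftrightarrow> glued G W2 W1"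
  unfolding glued_def by (blast dest: adj_commute[THEN iffD1])

lemma glued_edges:
  assumes "glued G W1 W2"
  shows "edges G = edges (induced G W1) \<union> edges (induced G W2)"
proof -
  have "e \<subseteq> W1 \<or> e \<subseteq> W2" if "e \<in> edges G" for e
  proof -
    have d: "digital_space G" using assms by (simp add: glued_def)
    obtain x y where "e = {x, y}" "x \<in> verts G" "y \<in> verts G" "adj G x y"
      by (rule digital_edgeE[OF d \<open>e \<in> edges G\<close>])
    moreover from this have "adj G y x" by (simp add: adj_commute)
    ultimately show ?thesis using assms by (auto simp: glued_def)
  qed
  then show ?thesis by (auto simp: induced_def)
qed

lemma glued_iso:
  assumes "glued G W1 W2" "graph_iso f G H" "digital_space H"
  shows "glued H (f ` W1) (f ` W2)" "f ` W1 \<inter> f ` W2 = f ` (W1 \<inter> W2)"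
proof -
  note f = graph_isoD[OF assms(2)]
  have v: "verts G = W1 \<union> W2" using assms(1) by (simp add: glued_def)
  with f(2) show "f ` W1 \<inter> f ` W2 = f ` (W1 \<inter> W2)"
    by (intro inj_on_image_Int[symmetric, of f "verts G"]) auto
  have "\<not> adj H x y" if xy: "x \<in> f ` W1 - f ` W2" "y \<in> f ` W2 - f ` W1" for x y
  proof -
    from xy obtain a b where "x = f a" "y = f b" "a \<in> W1 - W2" "b \<in> W2 - W1" by blast
    with assms(1) v f(4)[of a b] show ?thesis by (auto simp: glued_def)
  qed
  with v f(3) assms(3) show "glued H (f ` W1) (f ` W2)" by (auto simp: glued_def)
qed

lemma sphere_glued_ge2:
  assumes n: "n \<ge> 2" and G: "glued G W1 W2"
    and D1: "disk n (induced G W1) (W1 \<inter> W2)" and D2: "disk n (induced G W2) (W1 \<inter> W2)"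
  shows "sphere n G"
proof -
  have dg: "digital_space G" and v: "verts G = W1 \<union> W2" using G by (simp_all add: glued_def)
  let ?B = "W1 \<inter> W2" and ?D = "induced G W1" and ?E = "induced G W2"
  have "verts ?D = W1" "verts ?E = W2" using v by auto
  then have "finite (verts G)" using v disk_finite[OF D1] disk_finite[OF D2] by simp
  then obtain K where K: "\<And>x. x \<in> verts G \<Longrightarrow> x < K"
    unfolding finite_nat_set_iff_bounded by auto
  define s :: "nat \<Rightarrow> nat" where "s x = x + K" for x
  define C where "C = rename s ?E"
  define h where "h x = (if x \<in> W1 then x else s x)" for x
  have s: "inj s" by (auto simp: s_def inj_on_def)
  have disj: "s x \<notin> verts G" for x using K[of "s x"] by (auto simp: s_def)
  have dC: "digital_space C" and isoC: "graph_iso s ?E C"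
    unfolding C_def
    using digital_rename[OF digital_induced[OF dg] inj_on_subset[OF s subset_UNIV], of W2]
      graph_iso_rename[OF digital_induced[OF dg] inj_on_subset[OF s subset_UNIV], of W2] by this
  have h: "inj_on h (verts G)"
  proof (rule inj_onI)
    fix x y assume "x \<in> verts G" "y \<in> verts G" "h x = h y"
    then show "x = y"
      using disj[of x] disj[of y] by (auto simp: h_def inj_eq[OF s] split: if_splits)
  qed
  have vC: "verts C = s ` W2" using v by (simp add: C_def Int_absorb1)
  have iso: "graph_iso s (induced ?D ?B) (induced C (s ` ?B))"
    using graph_iso_induced[OF isoC, of ?B] v
    by (simp add: induced_induced) (simp add: Int_ac Int_absorb1)
  define r where "r y = (if y \<in> s ` ?B then inv_into ?B s y else y)" for y
  have rs: "r (s x) = h x" if "x \<in> W2" for x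
    using that s by (auto simp: r_def h_def inj_image_mem_iff inj_on_subset inv_into_f_f)
  have "verts (identify ?D ?B s C) = verts (rename h G)"
    using v vC rs by (auto simp: identify_def Let_def r_def[symmetric] h_def image_image)
  moreover have "edges (identify ?D ?B s C) = edges (rename h G)"
  proof -
    have "(\<lambda>e. r ` e) ` edges C = (\<lambda>e. h ` e) ` edges ?E"
      unfolding C_def rename_def using rs by (force simp: image_image induced_def intro!: image_cong)
    moreover have "edges ?D = (\<lambda>e. h ` e) ` edges ?D"
    proof -
      have "h ` e = e" if "e \<in> edges ?D" for e
        using that by (force simp: induced_def h_def)
      then show ?thesis by simp
    qed
    ultimately show ?thesis
      using glued_edges[OF G] by (simp add: identify_def Let_def r_def[symmetric] rename_def image_Un)
  qed
  ultimately have id: "identify ?D ?B s C = rename h G"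
    by (simp add: dgraph.expand)
  have "isomorphic (rename h G) G"
    using graph_iso_inv[OF graph_iso_rename[OF dg h]] by (auto simp: isomorphic_def)
  moreover have "disk n C (s ` ?B)" using disk_iso[OF D2 isoC dC] .
  moreover have "verts ?D \<inter> verts C = {}" using disj vC by auto
  ultimately show ?thesis
    using n D1 iso dg by (intro sphere_n[of n ?D ?B C "s ` ?B" s]) (simp_all add: id)
qed

lemma identify_glued:
  assumes D: "digital_space D" "BD \<subseteq> verts D" and C: "digital_space C" "BC \<subseteq> verts C"
    and disj: "verts D \<inter> verts C = {}" and f: "graph_iso f (induced D BD) (induced C BC)"
  defines "I \<equiv> identify D BD f C"
  obtains r where "glued I (verts D) (r ` verts C)" "verts D \<inter> r ` verts C = BD"
    "induced I (verts D) = D" "graph_iso r C (induced I (r ` verts C))" "r ` BC = BD"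
proof -
  define r where "r y = (if y \<in> f ` BD then inv_into BD f y else y)" for y
  have vB: "verts (induced D BD) = BD" "verts (induced C BC) = BC" using D C by auto
  have fB: "inj_on f BD" "f ` BD = BC" using graph_isoD(2,3)[OF f] vB by auto
  have fadj: "adj C (f u) (f v) \<longleftrightarrow> adj D u v" if "u \<in> BD" "v \<in> BD" for u v
    using graph_isoD(4)[OF f] vB that fB by auto
  have rf: "r (f u) = u" if "u \<in> BD" for u using that fB(1) by (simp add: r_def)
  have rC: "r y = y" if "y \<notin> BC" for y using that fB by (simp add: r_def)
  have rD: "\<exists>u\<in>BD. y = f u \<and> r y = u" if "y \<in> verts C" "r y \<in> verts D" for y
    using that rC[of y] rf disj fB(2) by (cases "y \<in> BC") auto
  have inj: "inj_on r (verts C)"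
  proof (rule inj_onI)
    fix y z assume yz: "y \<in> verts C" "z \<in> verts C" "r y = r z"
    show "y = z"
    proof (cases "r y \<in> verts D")
      case True
      with yz show ?thesis using rD[of y] rD[of z] by auto
    next
      case False
      then have "y \<notin> BC" "z \<notin> BC" using rf fB(2) D(2) yz(3) by auto
      with yz rC show ?thesis by simp
    qed
  qed
  have vI: "verts I = verts D \<union> r ` verts C"
    and eI: "edges I = edges D \<union> edges (rename r C)"
    by (simp_all add: I_def identify_def Let_def r_def[symmetric] rename_def)
  have ren: "graph_iso r C (rename r C)" "digital_space (rename r C)"
    using graph_iso_rename digital_rename C(1) inj by auto
  have dI: "digital_space I"
    using D(1) ren(2) vI eI by (auto simp: digital_space_def)
  have adjI: "adj I x y \<longleftrightarrow> adj D x y \<or> adj (rename r C) x y" for x y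
    by (simp add: adj_def eI)
  have B: "verts D \<inter> r ` verts C = BD"
    using rD rf fB(2) C(2) D(2) by force
  have renD: "adj D x y" if "adj (rename r C) x y" "x \<in> verts D" "y \<in> verts D" for x y
  proof -
    obtain a b where ab: "a \<in> verts C" "b \<in> verts C" "x = r a" "y = r b"
      using adj_digital(1,2)[OF ren(2) \<open>adj (rename r C) x y\<close>] by auto
    then have "adj C a b" using \<open>adj (rename r C) x y\<close> graph_isoD(4)[OF ren(1)] by simp
    moreover obtain u w where "u \<in> BD" "a = f u" "r a = u" "w \<in> BD" "b = f w" "r b = w"
      using ab \<open>x \<in> verts D\<close> \<open>y \<in> verts D\<close> rD[of a] rD[of b] by auto
    ultimately show ?thesis using ab fadj by simp
  qed
  have renC: "adj (rename r C) x y" if xy: "adj D x y" "x \<in> r ` verts C" "y \<in> r ` verts C" for x y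
  proof -
    have "x \<in> BD" "y \<in> BD" using B adj_digital(1,2)[OF D(1) xy(1)] xy by auto
    moreover from this have "adj C (f x) (f y)" using fadj xy(1) by simp
    moreover have "f x \<in> verts C" "f y \<in> verts C" using calculation fB C(2) by auto
    ultimately show ?thesis using graph_isoD(4)[OF ren(1), of "f x" "f y"] rf by simp
  qed
  show thesis
  proof (rule that[of r])
    show "glued I (verts D) (r ` verts C)"
      using dI vI adj_digital(1,2)[OF D(1)] adj_digital(1,2)[OF ren(2)]
      by (fastforce simp: glued_def adjI)
    show "induced I (verts D) = D"
      using dI D(1) vI renD by (intro dgraph_eqI) (auto simp: adjI)
    have "induced I (r ` verts C) = rename r C"
      using dI ren(2) vI renC by (intro dgraph_eqI) (auto simp: adjI)
    with ren(1) show "graph_iso r C (induced I (r ` verts C))" by simp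
    show "r ` BC = BD" using rf fB(2) by force
  qed (rule B)
qed

lemma sphere_gluedE:
  assumes "sphere n G" "n \<ge> 2"
  obtains W1 W2 where "glued G W1 W2" "disk n (induced G W1) (W1 \<inter> W2)"
    "disk n (induced G W2) (W1 \<inter> W2)"
  using assms(1)
proof cases
  case (sphere_n D BD C BC f)
  obtain r where r: "glued (identify D BD f C) (verts D) (r ` verts C)" "verts D \<inter> r ` verts C = BD"
    "induced (identify D BD f C) (verts D) = D"
    "graph_iso r C (induced (identify D BD f C) (r ` verts C))" "r ` BC = BD"
    using identify_glued[of D BD C BC f] sphere_n disk_digital disk_boundary_subset by metis
  let ?I = "identify D BD f C"
  obtain g where g: "graph_iso g ?I G" using sphere_n(7) by (auto simp: isomorphic_def)
  let ?W1 = "g ` verts D" and ?W2 = "g ` r ` verts C"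
  have v: "verts D \<subseteq> verts ?I" "r ` verts C \<subseteq> verts ?I" using r(1) by (auto simp: glued_def)
  note gl = glued_iso[OF r(1) g sphere_n(6)]
  have i1: "graph_iso g D (induced G ?W1)" using graph_iso_induced[OF g v(1)] r(3) by simp
  have i2: "graph_iso (g \<circ> r) C (induced G ?W2)"
    using graph_iso_comp[OF r(4) graph_iso_induced[OF g v(2)]] .
  show ?thesis
  proof (rule that[of ?W1 ?W2])
    show "disk n (induced G ?W1) (?W1 \<inter> ?W2)"
      using disk_iso[OF sphere_n(2) i1] sphere_n(6) gl(2) r(2) by simp
    show "disk n (induced G ?W2) (?W1 \<inter> ?W2)"
      using disk_iso[OF sphere_n(3) i2] sphere_n(6) gl(2) r(2) by (simp only: r(5)[symmetric] image_comp digital_induced)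
  qed (rule gl(1))
qed (use assms(2) in auto)

section \<open>Punctured manifolds and spheres\<close>

lemma manifold_bd_add_point:
  assumes "manifold_bd n D B" "w \<notin> verts D"
  shows "closed_manifold n (add_point D w B)" "B \<subseteq> verts D"
proof -
  obtain M v f where M: "closed_manifold n M" "v \<in> verts M" "digital_space D"
    "graph_iso f (delete_point M v) D" "B = f ` nbrs M v"
    using assms(1) by (auto simp: manifold_bd_iff)
  have dM: "digital_space M" using M(1) by (simp add: closed_manifold_iff)
  have "nbrs M v \<subseteq> verts (delete_point M v)" using dM nbrs_subset by auto
  then show B: "B \<subseteq> verts D" using graph_isoD(3)[OF M(4)] M(5) by blast
  show "closed_manifold n (add_point D w B)"
    using closed_manifold_iso[OF M(1) graph_iso_add_point[OF M(4) dM M(3,2) assms(2)]] M(3,5) B assms(2)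
    by simp
qed

lemma manifold_bd_delete_point:
  assumes "closed_manifold n M" "v \<in> verts M" "dconnected (delete_point M v)"
  shows "manifold_bd n (delete_point M v) (nbrs M v)"
  using manifold_bd[of n M v "delete_point M v" id] assms by (simp add: closed_manifold_iff)

lemma sphere_nonempty:
  assumes "sphere n G"
  shows "verts G \<noteq> {}"
proof -
  consider "n = 0" | "n = Suc 0" | "n \<ge> 2" by linarith
  then show ?thesis
  proof cases
    case 3
    then obtain W1 W2 where "glued G W1 W2" "disk n (induced G W1) (W1 \<inter> W2)"
      by (rule sphere_gluedE[OF assms])
    with 3 show ?thesis by (auto simp: disk_n_iff manifold_bd_iff dconnected_def)
  qed (use assms in \<open>auto simp: sphere_0_iff sphere_1_iff dconnected_def\<close>)
qed

lemma contractible_delete_point_adj: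
  assumes "digital_space M" "adj M u v"
    and "contractible (delete_point (rim M u) v)" "contractible (delete_point (rim M v) u)"
    and "contractible (delete_point M u)"
  shows "contractible (delete_point M v)"
proof -
  have uv: "u \<in> verts M" "v \<in> verts M" "u \<noteq> v" using adj_digital[OF assms(1,2)] by auto
  have rim: "rim (delete_point M x) y = delete_point (rim M y) x" if "x \<noteq> y" for x y
    using assms(1) that by (intro dgraph_eqI) (auto simp: mem_nbrs)
  have "delete_point (delete_point M u) v = delete_point (delete_point M v) u"
    using assms(1) by (intro dgraph_eqI) auto
  moreover have "contractible (delete_point (delete_point M u) v)"
    using contractible_delete_point_iff[of "delete_point M u" v] assms uv rim[of u v] by simp
  ultimately show ?thesis
    using contractible_delete_point_iff[of "delete_point M v" u] assms uv rim[of v u] by simp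
qed

lemma closed_manifold_contractible_delete:
  assumes M: "closed_manifold n M"
    and rims: "\<And>Q x. sphere (n - 1) Q \<Longrightarrow> x \<in> verts Q \<Longrightarrow> contractible (delete_point Q x)"
    and u: "u \<in> verts M" "contractible (delete_point M u)" and v: "v \<in> verts M"
  shows "contractible (delete_point M v)"
proof -
  have d: "digital_space M" and sph: "\<And>x. x \<in> verts M \<Longrightarrow> sphere (n - 1) (rim M x)"
    using M by (auto simp: closed_manifold_iff)
  have "(adj M)\<^sup>*\<^sup>* u v" using M u(1) v by (simp add: closed_manifold_iff dconnected_def)
  then show ?thesis
  proof induction
    case (step y z)
    have yz: "y \<in> verts M" "z \<in> verts M" "z \<in> nbrs M y" "y \<in> nbrs M z"
      using adj_digital[OF d step(2)] step(2) d by (auto simp: mem_nbrs adj_commute)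
    show ?case
      using rims[OF sph[OF yz(1)], of z] rims[OF sph[OF yz(2)], of y] yz(3,4)
      by (intro contractible_delete_point_adj[OF d step(2) _ _ step(3)]) simp_all
  qed (rule u(2))
qed

lemma closed_manifold_no_apex:
  assumes M: "closed_manifold n M" and v: "v \<in> verts M"
    and rims: "\<And>Q u. sphere (n - 1) Q \<Longrightarrow> u \<in> verts Q \<Longrightarrow> \<exists>x\<in>verts Q. x \<noteq> u \<and> \<not> adj Q u x"
  shows "\<exists>x\<in>verts M. x \<noteq> v \<and> \<not> adj M v x"
proof -
  have d: "digital_space M" and sph: "\<And>x. x \<in> verts M \<Longrightarrow> sphere (n - 1) (rim M x)"
    using M by (auto simp: closed_manifold_iff)
  obtain y where y: "y \<in> nbrs M v" using sphere_nonempty[OF sph[OF v]] by auto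
  then have "y \<in> verts M" "v \<in> nbrs M y"
    using adj_digital(2)[OF d, of v y] d by (auto simp: mem_nbrs adj_commute)
  then obtain x where "x \<in> nbrs M y" "x \<noteq> v" "\<not> adj M v x"
    using rims[OF sph, of y v] by auto
  then show ?thesis using nbrs_subset by blast
qed

lemma path_contractible:
  assumes "finite (verts G)" "digital_space G" "dconnected G"
    and "\<And>v. card (nbrs G v) \<le> 2" "x \<in> verts G" "card (nbrs G x) \<le> 1"
  shows "contractible G \<and> (verts G = {x} \<or> (\<exists>z\<in>verts G. z \<noteq> x \<and> card (nbrs G z) \<le> 1))"
  using assms
proof (induction "card (verts G)" arbitrary: G x rule: less_induct)
  case less
  note d = less.prems(2)
  have fin: "finite (nbrs G v)" for v
    using finite_subset[OF nbrs_subset less.prems(1)] .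
  show ?case
  proof (cases "verts G = {x}")
    case True
    with d have "G = point_graph x" by (intro dgraph_eqI) auto
    with True show ?thesis by (simp add: contractible_point)
  next
    case False
    with less.prems(5) obtain y0 where "y0 \<in> verts G" "y0 \<noteq> x" by auto
    with less.prems(3,5) have "(adj G)\<^sup>*\<^sup>* x y0" by (simp add: dconnected_def)
    with \<open>y0 \<noteq> x\<close> obtain y where "adj G x y" by (auto elim: converse_rtranclpE)
    with d have "y \<in> nbrs G x" by (simp add: mem_nbrs)
    moreover from this have "card (nbrs G x) = 1"
      using less.prems(6) fin by (metis One_nat_def card_gt_0_iff empty_iff le_antisym Suc_leI)
    ultimately have ny: "nbrs G x = {y}" by (auto simp: card_1_singleton_iff)
    have y: "y \<in> verts G" "y \<noteq> x" "adj G x y" "adj G y x"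
      using ny d nbrs_subset[of G x] mem_nbrs[OF d, of y x] adj_commute[of G x y]
        nbrs_irrefl[OF d, of x] by auto
    have rim: "rim G x = point_graph y"
      using d ny by (intro dgraph_eqI) auto
    let ?H = "delete_point G x"
    have nH: "nbrs ?H v = nbrs G v - {x}" if "v \<noteq> x" for v
      using that d by (auto simp: mem_nbrs)
    have "nbrs ?H x = {}" using d by (auto simp: mem_nbrs)
    then have degH: "card (nbrs ?H v) \<le> 2" for v
      using nH[of v] less.prems(4)[of v] card_Diff1_le[of "nbrs G v" x] by (cases "v = x") auto
    have "dconnected ?H"
      by (rule dconnected_delete_point[OF d less.prems(3)])
        (auto simp: rim dconnected_def)
    moreover have "card (nbrs ?H y) \<le> 1"
      using nH[of y] y less.prems(4)[of y] mem_nbrs[OF d, of x y] fin[of y] by simp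
    moreover have "card (verts ?H) < card (verts G)"
      using less.prems(1,5) by (simp add: card_Diff1_less del: card_Diff_insert)
    ultimately have IH: "contractible ?H"
      "verts ?H = {y} \<or> (\<exists>z\<in>verts ?H. z \<noteq> y \<and> card (nbrs ?H z) \<le> 1)"
      using less.hyps[of ?H y] less.prems(1) d degH y by auto
    from IH(1) have "contractible G"
      using contractible_delete_point_iff[OF d less.prems(5)] rim contractible_point by simp
    moreover from IH(2) have "\<exists>z\<in>verts G. z \<noteq> x \<and> card (nbrs G z) \<le> 1"
    proof
      assume "verts ?H = {y}"
      then have "nbrs G y \<subseteq> {x}" using nbrs_subset[of G y] nbrs_irrefl[OF d, of y] by auto
      then have "card (nbrs G y) \<le> card {x}" by (intro card_mono) auto
      with y show ?thesis by auto
    next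
      assume "\<exists>z\<in>verts ?H. z \<noteq> y \<and> card (nbrs ?H z) \<le> 1"
      then obtain z where z: "z \<in> verts G" "z \<noteq> x" "z \<noteq> y" "card (nbrs ?H z) \<le> 1" by auto
      have "z \<notin> nbrs G x" using z ny by simp
      then have "x \<notin> nbrs G z" using d by (simp add: mem_nbrs adj_commute)
      with z nH[of z] show ?thesis by auto
    qed
    ultimately show ?thesis by blast
  qed
qed

lemma sphere_1_delete_point:
  assumes "sphere (Suc 0) G" "v \<in> verts G"
  shows "dconnected (delete_point G v)" "contractible (delete_point G v)"
proof -
  have d: "digital_space G" and fin: "finite (verts G)" and con: "dconnected G"
    and rims: "\<And>x. x \<in> verts G \<Longrightarrow> sphere 0 (rim G x)"
    using assms(1) by (auto simp: sphere_1_iff)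
  have deg: "card (nbrs G x) = 2" if "x \<in> verts G" for x
    using rims[OF that] by (auto simp: sphere_0_iff)
  have deg0: "nbrs G x = {}" if "x \<notin> verts G" for x
    using that adj_digital[OF d] by (auto simp: mem_nbrs[OF d])
  have finn: "finite (nbrs G x)" for x using finite_subset[OF nbrs_subset fin] .
  obtain a b where ab: "a \<noteq> b" "nbrs G v = {a, b}"
    using rims[OF assms(2)] by (auto simp: sphere_0_iff)
  have abv: "a \<in> verts G" "a \<noteq> v" "b \<in> verts G" "b \<noteq> v" "adj G a v"
    using ab(2) nbrs_subset[of G v] nbrs_irrefl[OF d, of v] mem_nbrs[OF d, of a v]
    by (auto simp: adj_commute)
  let ?H = "delete_point G v"
  define K where "K = {x. (adj ?H)\<^sup>*\<^sup>* a x}"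
  have aK: "a \<in> K" by (simp add: K_def)
  have Kstep: "y \<in> K" if "x \<in> K" "adj G x y" "y \<noteq> v" "x \<noteq> v" for x y
    using that d by (auto simp: K_def intro: rtranclp.rtrancl_into_rtrancl)
  have KH: "x \<in> verts G \<and> x \<noteq> v" if "x \<in> K" for x
  proof -
    have "(adj ?H)\<^sup>*\<^sup>* a x" using that by (simp add: K_def)
    then show ?thesis by induction (use abv d adj_digital[OF d] in auto)
  qed
  let ?K = "induced G K"
  have vK: "verts ?K = K" using KH by auto
  have "v \<notin> K" using KH[of v] by auto
  then have nK: "nbrs ?K x = nbrs G x - {v}" if "x \<in> K" for x
    using that KH[OF that] Kstep[OF that] by (auto simp: nbrs_induced[OF d] mem_nbrs[OF d])
  have conK: "dconnected ?K"
  proof (rule connected_reach[of a])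
    fix x assume "x \<in> verts ?K"
    then have "(adj ?H)\<^sup>*\<^sup>* a x" by (simp add: K_def)
    then have "(adj ?K)\<^sup>*\<^sup>* a x \<and> x \<in> K"
    proof induction
      case (step y z)
      then have "z \<in> K" using Kstep[of y z] d by auto
      with step d have "adj ?K y z" by auto
      with step \<open>z \<in> K\<close> show ?case by (auto intro: rtranclp.rtrancl_into_rtrancl)
    qed (simp add: aK)
    then show "(adj ?K)\<^sup>*\<^sup>* a x" ..
  qed (use vK aK in simp)
  have degK: "card (nbrs ?K x) \<le> 2" for x
  proof -
    have "nbrs ?K x \<subseteq> nbrs G x" using d by (auto simp: mem_nbrs)
    then have "card (nbrs ?K x) \<le> card (nbrs G x)" by (intro card_mono finn)
    then show ?thesis using deg[of x] deg0[of x] by (cases "x \<in> verts G") auto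
  qed
  have va: "v \<in> nbrs G a" using abv d by (simp add: mem_nbrs)
  have "card (nbrs ?K a) \<le> 1" using nK[OF aK] va deg[OF abv(1)] finn[of a] by simp
  then have "K = {a} \<or> (\<exists>z\<in>K. z \<noteq> a \<and> card (nbrs ?K z) \<le> 1)"
    using path_contractible[of ?K a] fin d conK degK aK vK by auto
  moreover have "K \<noteq> {a}"
  proof
    assume "K = {a}"
    then have "nbrs G a - {v} \<subseteq> {a}" using nK[OF aK] vK nbrs_subset[of ?K a] by simp
    then have "nbrs G a \<subseteq> {v}" using nbrs_irrefl[OF d, of a] by auto
    then have "card (nbrs G a) \<le> card {v}" by (intro card_mono) auto
    then show False using deg[OF abv(1)] by simp
  qed
  ultimately obtain z where z: "z \<in> K" "z \<noteq> a" "card (nbrs ?K z) \<le> 1" by auto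
  have "v \<in> nbrs G z"
  proof (rule ccontr)
    assume "v \<notin> nbrs G z"
    then have "card (nbrs ?K z) = 2" using nK[OF z(1)] deg KH[OF z(1)] by simp
    with z(3) show False by simp
  qed
  then have "z \<in> nbrs G v" using d by (simp add: mem_nbrs adj_commute)
  with ab z have "b \<in> K" by auto
  then show con': "dconnected ?H"
    using ab(2) by (intro dconnected_delete_point_reach[OF d con, of a]) (auto simp: K_def)
  have nH: "nbrs ?H x \<subseteq> nbrs G x" for x using d by (auto simp: mem_nbrs)
  have "card (nbrs ?H x) \<le> 2" for x
    using card_mono[OF finn nH, of x] deg[of x] deg0[of x] by (cases "x \<in> verts G") auto
  moreover have "nbrs ?H a = nbrs G a - {v}" using d abv by (auto simp: mem_nbrs)
  then have "card (nbrs ?H a) \<le> 1" using va deg[OF abv(1)] finn[of a] by simp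
  ultimately show "contractible ?H"
    using path_contractible[of ?H a] fin d con' abv by auto
qed

lemma closed_manifold_glued:
  assumes G: "glued G W1 W2" and w: "w \<notin> verts G"
    and M1: "closed_manifold n (add_point (induced G W1) w (W1 \<inter> W2))"
    and M2: "closed_manifold n (add_point (induced G W2) w (W1 \<inter> W2))"
    and con: "dconnected (induced G W1)" "dconnected (induced G W2)"
    and glue: "\<And>H A1 A2. glued H A1 A2 \<Longrightarrow> disk (n - 1) (induced H A1) (A1 \<inter> A2) \<Longrightarrow>
      disk (n - 1) (induced H A2) (A1 \<inter> A2) \<Longrightarrow> sphere (n - 1) H"
    and punct: "\<And>Q v. sphere (n - 1) Q \<Longrightarrow> v \<in> verts Q \<Longrightarrow>
      disk (n - 1) (delete_point Q v) (nbrs Q v)"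
  shows "closed_manifold n G"
proof -
  have d: "digital_space G" and v: "verts G = W1 \<union> W2" using G by (auto simp: glued_def)
  let ?M = "\<lambda>W. add_point (induced G W) w (W1 \<inter> W2)"
  have int: "sphere (n - 1) (rim G x)"
    if gl: "glued G U1 U2" and "W1 \<inter> W2 = U1 \<inter> U2" and M: "closed_manifold n (?M U1)" and x: "x \<in> U1 - U2"
    for U1 U2 x
  proof -
    have u: "verts G = U1 \<union> U2" using gl by (simp add: glued_def)
    have "nbrs G x \<subseteq> U1"
    proof
      fix y assume "y \<in> nbrs G x"
      then have "adj G x y" "y \<in> verts G" using d nbrs_subset by (auto simp: nbrs_def)
      with gl x show "y \<in> U1" by (auto simp: glued_def)
    qed
    moreover have "nbrs (?M U1) x = nbrs G x \<inter> U1"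
      using that d u w by (subst nbrs_add_point) (auto simp: nbrs_induced)
    ultimately have "rim (?M U1) x = rim G x"
      using d M nbrs_subset[of G x] w
      by (intro dgraph_eqI digital_rim) (auto simp: closed_manifold_iff)
    then show ?thesis using M x u by (auto simp: closed_manifold_iff)
  qed
  have bd: "disk (n - 1) (induced (rim G x) (nbrs G x \<inter> W)) (nbrs G x \<inter> (W1 \<inter> W2))"
    if x: "x \<in> W1 \<inter> W2" and W: "W = W1 \<or> W = W2" and M: "closed_manifold n (?M W)" for x W
  proof -
    let ?R = "rim (?M W) x"
    have dM: "digital_space (?M W)" and sR: "sphere (n - 1) ?R"
      using M x W v by (auto simp: closed_manifold_iff)
    have nx: "nbrs (?M W) x = insert w (nbrs G x \<inter> W)"
      using x W v w d by (subst nbrs_add_point) (auto simp: nbrs_induced)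
    have nw: "nbrs (?M W) w = W1 \<inter> W2"
      using W v w d by (subst nbrs_add_point) auto
    have "w \<notin> nbrs G x" using w nbrs_subset by blast
    then have "delete_point ?R w = induced (rim G x) (nbrs G x \<inter> W)"
      using d dM nx by (intro dgraph_eqI) auto
    moreover have "nbrs ?R w = nbrs G x \<inter> (W1 \<inter> W2)"
      using nx nw W w nbrs_subset[of G x] d dM mem_nbrs[OF dM, of _ w] v
      by (auto simp: rim_def nbrs_induced)
    ultimately show ?thesis using punct[OF sR, of w] nx by simp
  qed
  have "sphere (n - 1) (rim G x)" if x: "x \<in> verts G" for x
  proof -
    consider "x \<in> W1 - W2" | "x \<in> W2 - W1" | "x \<in> W1 \<inter> W2" using x v by blast
    then show ?thesis
    proof cases
      case 1
      with int[OF G _ M1] show ?thesis by simp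
    next
      case 2
      with int[OF G[THEN glued_commute[THEN iffD1]] _ M2] show ?thesis by (simp add: Int_commute)
    next
      case 3
      have "(nbrs G x \<inter> W1) \<inter> (nbrs G x \<inter> W2) = nbrs G x \<inter> (W1 \<inter> W2)" by blast
      moreover have "glued (rim G x) (nbrs G x \<inter> W1) (nbrs G x \<inter> W2)"
        using G nbrs_subset[of G x] by (auto simp: glued_def)
      ultimately show ?thesis using bd[OF 3 _ M1] bd[OF 3 _ M2] by (intro glue) auto
    qed
  qed
  moreover have "W1 \<inter> W2 \<noteq> {}"
  proof -
    have "sphere (n - 1) (rim (?M W1) w)" using M1 by (simp add: closed_manifold_iff)
    moreover have "nbrs (?M W1) w = W1 \<inter> W2" using v w d by (subst nbrs_add_point) auto
    ultimately show ?thesis using sphere_nonempty by fastforce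
  qed
  then have "dconnected G" using dconnected_union[OF v con] by blast
  ultimately show ?thesis using M1 d by (simp add: closed_manifold_iff)
qed

lemma sphere_0_delete_point:
  assumes "sphere 0 Q" "v \<in> verts Q"
  obtains b where "delete_point Q v = point_graph b" "nbrs Q v = {}" "b \<in> verts Q" "b \<noteq> v"
proof -
  have d: "digital_space Q" using assms(1) by (rule sphere_digital)
  obtain a b where ab: "a \<noteq> b" "verts Q = {a, b}" "\<not> adj Q a b"
    using assms(1) by (auto simp: sphere_0_iff)
  then have n: "\<not> adj Q x y" for x y
    using adj_digital[OF d, of x y] adj_commute[of Q a b] by auto
  have nb: "nbrs Q v = {}" using n by (auto simp: nbrs_def)
  show ?thesis
  proof (cases "v = a")
    case True
    then have "delete_point Q v = point_graph b" using ab d n by (intro dgraph_eqI) auto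
    with that[of b] nb ab True show ?thesis by simp
  next
    case False
    then have "v = b" using assms(2) ab by simp
    then have "delete_point Q v = point_graph a" using ab d n by (intro dgraph_eqI) auto
    with that[of a] nb ab \<open>v = b\<close> show ?thesis by simp
  qed
qed

lemma sphere_0_glued:
  assumes G: "glued G W1 W2" and D: "disk 0 (induced G W1) (W1 \<inter> W2)" "disk 0 (induced G W2) (W1 \<inter> W2)"
  shows "sphere 0 G"
proof -
  have d: "digital_space G" and v: "verts G = W1 \<union> W2" using G by (auto simp: glued_def)
  obtain a b where ab: "induced G W1 = point_graph a" "induced G W2 = point_graph b" "W1 \<inter> W2 = {}"
    using D by (auto simp: disk_0_iff)
  have "verts (induced G W1) = W1" "verts (induced G W2) = W2" using v by auto
  then have W: "W1 = {a}" "W2 = {b}" using ab by simp_all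
  then have "a \<noteq> b" "verts G = {a, b}" using ab(3) v by auto
  moreover from this have "\<not> adj G a b" using G W by (simp add: glued_def)
  ultimately show ?thesis using d by (auto simp: sphere_0_iff)
qed

lemma sphere_1_glued:
  assumes G: "glued G W1 W2"
    and D: "disk (Suc 0) (induced G W1) (W1 \<inter> W2)" "disk (Suc 0) (induced G W2) (W1 \<inter> W2)"
  shows "sphere (Suc 0) G"
proof -
  have d: "digital_space G" and v: "verts G = W1 \<union> W2" using G by (auto simp: glued_def)
  have "verts (induced G W1) = W1" "verts (induced G W2) = W2" using v by auto
  then have fin: "finite (verts G)" using disk_finite[OF D(1)] disk_finite[OF D(2)] v by simp
  then obtain w where w: "w \<notin> verts G" using ex_new_if_finite infinite_UNIV_nat by metis
  have M: "closed_manifold (Suc 0) (add_point (induced G W) w B)" "dconnected (induced G W)"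
    if disk: "disk (Suc 0) (induced G W) B" for W B
  proof -
    obtain S x f where S: "sphere (Suc 0) S" "x \<in> verts S" "graph_iso f (delete_point S x) (induced G W)"
      "B = f ` nbrs S x"
      using disk by (auto simp: disk_1_iff)
    have "digital_space S" using S(1) by (rule sphere_digital)
    with S show con: "dconnected (induced G W)"
      using dconnected_iso[OF sphere_1_delete_point(1)[OF S(1,2)] S(3)] by simp
    have "closed_manifold (Suc 0) S" using S(1) by (simp add: closed_manifold_iff sphere_1_iff)
    then have "manifold_bd (Suc 0) (induced G W) B"
      using manifold_bd[of "Suc 0" S x "induced G W" f] S con d by simp
    then show "closed_manifold (Suc 0) (add_point (induced G W) w B)"
      using w by (intro manifold_bd_add_point) simp_all
  qed
  have "closed_manifold (Suc 0) G"
  proof (rule closed_manifold_glued[OF G w M(1)[OF D(1)] M(1)[OF D(2)] M(2)[OF D(1)] M(2)[OF D(2)]])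
    show "sphere (Suc 0 - 1) H" if "glued H A1 A2" "disk (Suc 0 - 1) (induced H A1) (A1 \<inter> A2)"
      "disk (Suc 0 - 1) (induced H A2) (A1 \<inter> A2)" for H A1 A2
      using sphere_0_glued[of H A1 A2] that by simp
    show "disk (Suc 0 - 1) (delete_point Q x) (nbrs Q x)"
      if "sphere (Suc 0 - 1) Q" "x \<in> verts Q" for Q x
      using that sphere_0_delete_point[of Q x] by (auto simp: disk_0_iff)
  qed
  with fin show ?thesis by (simp add: closed_manifold_iff sphere_1_iff)
qed

lemma sphere_glued:
  assumes "glued G W1 W2" "disk n (induced G W1) (W1 \<inter> W2)" "disk n (induced G W2) (W1 \<inter> W2)"
  shows "sphere n G"
proof -
  consider "n = 0" | "n = Suc 0" | "n \<ge> 2" by linarith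
  then show ?thesis
    using assms sphere_0_glued sphere_1_glued sphere_glued_ge2 by cases auto
qed

lemma contractible_delete_cone_points:
  assumes "finite T" "finite (verts X)" "digital_space X" "w \<in> verts X" "T \<subseteq> verts X"
    and "\<And>t. t \<in> T \<Longrightarrow> adj X w t" "\<And>t x. t \<in> T \<Longrightarrow> adj X t x \<Longrightarrow> x \<noteq> w \<Longrightarrow> adj X w x"
  shows "contractible (induced X (verts X - T)) \<longleftrightarrow> contractible X"
  using assms
proof (induction T arbitrary: X rule: finite_induct)
  case empty
  then show ?case by (simp add: induced_verts)
next
  case (insert t T)
  note d = insert.prems(2)
  let ?Y = "delete_point X t"
  have tw: "t \<noteq> w" using insert.prems(5)[of t] d by auto
  have "contractible (induced ?Y (verts ?Y - T)) \<longleftrightarrow> contractible ?Y"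
    using insert.prems tw insert.hyps(2) by (intro insert.IH) auto
  moreover have "contractible (rim X t)"
  proof (rule cone_contractible[of _ w])
    show "finite (verts (rim X t))" using insert.prems(1) finite_subset[OF nbrs_subset] by simp
    show "w \<in> verts (rim X t)" using insert.prems(5)[of t] d by (simp add: mem_nbrs adj_commute)
    then show "adj (rim X t) w x" if "x \<in> verts (rim X t)" "x \<noteq> w" for x
      using that insert.prems(6)[of t x] d by (simp add: mem_nbrs)
  qed (use d in simp)
  then have "contractible ?Y \<longleftrightarrow> contractible X"
    using contractible_delete_point_iff[of X t] insert.prems(4) d by auto
  moreover have "induced ?Y (verts ?Y - T) = induced X (verts X - insert t T)"
    using d by (intro dgraph_eqI) auto
  ultimately show ?case by simp
qed

text \<open>The h-transformation of a disk to a point is a contractible transformation: cone off the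
  contractible disk, then every interior point has a cone as its rim.\<close>

lemma contractible_collapse:
  assumes G: "glued G W1 W2" and fin: "finite (verts G)" and w: "w \<notin> verts G"
    and c: "contractible (induced G W2)"
  shows "contractible (add_point (induced G W1) w (W1 \<inter> W2)) \<longleftrightarrow> contractible G"
proof -
  have d: "digital_space G" and v: "verts G = W1 \<union> W2"
    and cross: "\<And>x y. x \<in> W1 - W2 \<Longrightarrow> y \<in> W2 - W1 \<Longrightarrow> \<not> adj G x y"
    using G by (auto simp: glued_def)
  define X where "X = add_point G w W2"
  have dX: "digital_space X" and vX: "verts X = insert w (verts G)"
    using d w v by (auto simp: X_def)
  have nw: "\<not> adj G w x" "\<not> adj G x w" for x using adj_digital[OF d] w by blast+
  have "rim X w = induced G W2"
    using d dX v w nw by (intro dgraph_eqI digital_rim digital_induced) (auto simp: X_def mem_nbrs)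
  moreover have "delete_point X w = G"
    unfolding X_def using d w v by (intro delete_add_point) auto
  ultimately have 1: "contractible G \<longleftrightarrow> contractible X"
    using contractible_delete_point_iff[OF dX, of w] c vX by simp
  have 2: "contractible (induced X (verts X - (W2 - W1))) \<longleftrightarrow> contractible X"
  proof (rule contractible_delete_cone_points[of _ X w])
    show "adj X w x" if t: "t \<in> W2 - W1" "adj X t x" "x \<noteq> w" for t x
    proof -
      have a: "adj G t x" "adj G x t" using t w v by (auto simp: X_def adj_commute)
      then have "x \<in> W2" using cross[of x t] t adj_digital[OF d a(1)] v by blast
      then show ?thesis by (simp add: X_def)
    qed
  qed (use fin v vX dX in \<open>auto simp: X_def\<close>)
  have "induced X (verts X - (W2 - W1)) = add_point (induced G W1) w (W1 \<inter> W2)"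
    using d dX v w nw by (intro dgraph_eqI) (auto simp: X_def)
  with 1 2 show ?thesis by simp
qed

lemma sphere_structure:
  "sphere n G \<Longrightarrow> finite (verts G) \<and> (n \<ge> 1 \<longrightarrow> closed_manifold n G) \<and>
    (\<forall>v\<in>verts G. contractible (delete_point G v) \<and> disk n (delete_point G v) (nbrs G v) \<and>
      (\<exists>x\<in>verts G. x \<noteq> v \<and> \<not> adj G v x))"
proof (induction n arbitrary: G rule: less_induct)
  case (less n G)
  have rims: "contractible (delete_point Q v)" "disk (n - 1) (delete_point Q v) (nbrs Q v)"
    "\<exists>x\<in>verts Q. x \<noteq> v \<and> \<not> adj Q v x" if "sphere (n - 1) Q" "v \<in> verts Q" "n \<ge> 1" for Q v
    using less.IH[of "n - 1" Q] that by auto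
  consider "n = 0" | "n = Suc 0" | "n \<ge> 2" by linarith
  then show ?case
  proof cases
    case 1
    have "contractible (delete_point G v) \<and> disk 0 (delete_point G v) (nbrs G v) \<and>
      (\<exists>x\<in>verts G. x \<noteq> v \<and> \<not> adj G v x)" if v: "v \<in> verts G" for v
    proof -
      obtain b where "delete_point G v = point_graph b" "nbrs G v = {}" "b \<in> verts G" "b \<noteq> v"
        using sphere_0_delete_point[of G v] less.prems v 1 by auto
      then show ?thesis using contractible_point by (auto simp: disk_0_iff nbrs_def)
    qed
    then show ?thesis using less.prems 1 by (auto simp: sphere_0_iff)
  next
    case 2
    have d: "digital_space G" using less.prems by (rule sphere_digital)
    have M: "closed_manifold n G" using less.prems 2 by (simp add: closed_manifold_iff sphere_1_iff)
    have "contractible (delete_point G v) \<and> disk n (delete_point G v) (nbrs G v) \<and>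
      (\<exists>x\<in>verts G. x \<noteq> v \<and> \<not> adj G v x)" if v: "v \<in> verts G" for v
      using sphere_1_delete_point(2)[of G v] closed_manifold_no_apex[OF M v] rims(3)
        disk_1[of G v "delete_point G v" id] v less.prems 2 d by simp
    then show ?thesis using less.prems 2 M by (simp add: sphere_1_iff)
  next
    case 3
    obtain W1 W2 where G: "glued G W1 W2" and D: "disk n (induced G W1) (W1 \<inter> W2)"
      "disk n (induced G W2) (W1 \<inter> W2)"
      by (rule sphere_gluedE[OF less.prems 3])
    have d: "digital_space G" and v: "verts G = W1 \<union> W2" using G by (auto simp: glued_def)
    have vW: "verts (induced G W1) = W1" "verts (induced G W2) = W2" using v by auto
    then have fin: "finite (verts G)" using disk_finite[OF D(1)] disk_finite[OF D(2)] v by simp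
    then obtain w where w: "w \<notin> verts G" using ex_new_if_finite infinite_UNIV_nat by metis
    have mb: "manifold_bd n (induced G W1) (W1 \<inter> W2)" "manifold_bd n (induced G W2) (W1 \<inter> W2)"
      and c: "contractible (induced G W1)" "contractible (induced G W2)"
      using D 3 by (auto simp: disk_n_iff)
    let ?M = "\<lambda>W. add_point (induced G W) w (W1 \<inter> W2)"
    have M: "closed_manifold n (?M W1)" "closed_manifold n (?M W2)"
      using manifold_bd_add_point(1)[OF mb(1)] manifold_bd_add_point(1)[OF mb(2)] w vW v by auto
    have MG: "closed_manifold n G"
    proof (rule closed_manifold_glued[OF G w M])
      show "dconnected (induced G W1)" "dconnected (induced G W2)"
        using mb by (auto simp: manifold_bd_iff)
      show "disk (n - 1) (delete_point Q x) (nbrs Q x)" if "sphere (n - 1) Q" "x \<in> verts Q" for Q x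
        using rims(2)[OF that] 3 by simp
    qed (rule sphere_glued)
    have nbw: "nbrs (?M W1) w = W1 \<inter> W2" using w d v by (subst nbrs_add_point) auto
    have dM: "digital_space (?M W1)" using M by (simp add: closed_manifold_iff)
    have "w \<in> verts (?M W1)" by simp
    from closed_manifold_no_apex[OF M(1) this] rims(3) 3
    obtain p where "p \<in> verts (?M W1)" "p \<noteq> w" "p \<notin> nbrs (?M W1) w"
      using mem_nbrs[OF dM, of _ w] by auto
    then have p: "p \<in> W1" "p \<notin> W2" "p \<noteq> w" using nbw v by auto
    have dp: "delete_point (?M W1) p = add_point (induced (delete_point G p) (W1 - {p})) w ((W1 - {p}) \<inter> W2)"
      using dM d p w v by (intro dgraph_eqI digital_add_point digital_delete_point) auto
    have Mw: "delete_point (?M W1) w = induced G W1"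
      using d w v by (intro delete_add_point) auto
    have "contractible (delete_point (?M W1) p)"
      using closed_manifold_contractible_delete[OF M(1), of w p] rims(1) 3 c(1) Mw p(1) v by simp
    moreover have "glued (delete_point G p) (W1 - {p}) W2" "induced (delete_point G p) W2 = induced G W2"
      using G d p by (auto simp: glued_def intro!: dgraph_eqI)
    ultimately have Gp: "contractible (delete_point G p)"
      using contractible_collapse[of "delete_point G p" "W1 - {p}" W2 w] fin w c(2) dp by simp
    have cG: "contractible (delete_point G x)" if "x \<in> verts G" for x
      using closed_manifold_contractible_delete[OF MG _ _ Gp that] rims(1) 3 p(1) v by simp
    have "disk n (delete_point G x) (nbrs G x)" if x: "x \<in> verts G" for x
    proof -
      have "sphere (n - 1) (rim G x)" using MG x by (simp add: closed_manifold_iff)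
      moreover have "n - 1 \<ge> 1" using 3 by simp
      ultimately have "dconnected (rim G x)" using less.IH[of "n - 1" "rim G x"] 3
        by (simp add: closed_manifold_iff)
      then have "dconnected (delete_point G x)"
        using dconnected_delete_point d MG by (simp add: closed_manifold_iff)
      then show ?thesis using manifold_bd_delete_point[OF MG x] cG[OF x] 3 by (simp add: disk_n_iff)
    qed
    then show ?thesis using fin MG cG closed_manifold_no_apex[OF MG] rims(3) 3 by simp
  qed
qed

lemma sphere_finite: "sphere n G \<Longrightarrow> finite (verts G)"
  and sphere_closed_manifold: "sphere n G \<Longrightarrow> n \<ge> 1 \<Longrightarrow> closed_manifold n G"
  and sphere_delete_point: "sphere n G \<Longrightarrow> v \<in> verts G \<Longrightarrow> disk n (delete_point G v) (nbrs G v)"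
  using sphere_structure[of n G] by simp_all

lemma suspension_nbrs:
  assumes d: "digital_space G" and uw: "\<not> adj G u w"
    and apex: "\<And>x. x \<in> verts G - {u, w} \<Longrightarrow> adj G u x \<and> adj G w x"
  shows "nbrs G u = verts G - {u, w}" "nbrs G w = verts G - {u, w}"
proof -
  have "\<not> adj G w u" using uw by (simp add: adj_commute)
  with uw have "adj G u y \<longleftrightarrow> y \<in> verts G - {u, w}" "adj G w y \<longleftrightarrow> y \<in> verts G - {u, w}" for y
    by (metis DiffE DiffI adj_digital(2,3)[OF d] apex insert_iff empty_iff)+
  then show "nbrs G u = verts G - {u, w}" "nbrs G w = verts G - {u, w}"
    by (simp_all add: set_eq_iff mem_nbrs[OF d])
qed

lemma suspension_closed_manifold:
  assumes d: "digital_space G" and uw: "u \<in> verts G" "w \<in> verts G" "u \<noteq> w" "\<not> adj G u w"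
    and apex: "\<And>x. x \<in> verts G - {u, w} \<Longrightarrow> adj G u x \<and> adj G w x"
    and Q: "sphere n (induced G (verts G - {u, w}))"
    and rims: "\<And>x. x \<in> verts G - {u, w} \<Longrightarrow> sphere n (rim G x)"
  shows "closed_manifold (Suc n) G" "finite (verts G)"
proof -
  note nb = suspension_nbrs[OF d uw(4) apex]
  have "sphere n (rim G x)" if "x \<in> verts G" for x
  proof (cases "x = u \<or> x = w")
    case True
    then have "nbrs G x = verts G - {u, w}" using nb by blast
    then show ?thesis using Q by (simp add: rim_def)
  qed (use rims that in simp)
  moreover have "dconnected G"
  proof (rule connected_reach[OF uw(1)])
    obtain q where q: "q \<in> verts G - {u, w}" using sphere_nonempty[OF Q] by auto
    then have "adj G u q" "adj G q w" using apex[OF q] by (simp_all add: adj_commute)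
    then have "(adj G)\<^sup>*\<^sup>* u w" by (meson r_into_rtranclp rtranclp.rtrancl_into_rtrancl)
    then show "(adj G)\<^sup>*\<^sup>* u x" if "x \<in> verts G" for x
      using that apex[of x] by (cases "x = u \<or> x = w") auto
  qed
  ultimately show "closed_manifold (Suc n) G" using d by (simp add: closed_manifold_iff)
  show "finite (verts G)" using sphere_finite[OF Q] by (simp add: Int_absorb1)
qed

lemma sphere_suspension:
  assumes "digital_space G" "u \<in> verts G" "w \<in> verts G" "u \<noteq> w" "\<not> adj G u w"
    and "\<And>x. x \<in> verts G - {u, w} \<Longrightarrow> adj G u x \<and> adj G w x"
    and "sphere n (induced G (verts G - {u, w}))"
  shows "sphere (Suc n) G"
  using assms
proof (induction n arbitrary: G)
  case 0
  note d = 0(1)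
  obtain a b where ab: "a \<noteq> b" "verts G - {u, w} = {a, b}" "\<not> adj G a b"
    using 0(7) by (auto simp: sphere_0_iff)
  then have ba: "\<not> adj G b a" by (simp add: adj_commute)
  have "sphere 0 (rim G x)" if "x \<in> verts G - {u, w}" for x
  proof -
    have x: "x \<in> {a, b}" using that ab(2) by blast
    have "nbrs G x = {u, w}"
    proof
      have "\<not> adj G x y" if "y \<in> {a, b}" for y
        using that x ab(3) ba d by auto
      then show "nbrs G x \<subseteq> {u, w}"
        using ab(2) nbrs_subset[of G x] by (auto simp: nbrs_def)
      show "{u, w} \<subseteq> nbrs G x"
        using 0(6)[OF that] d by (simp add: mem_nbrs adj_commute)
    qed
    then show ?thesis unfolding sphere_0_iff using 0(1,4,5) by auto
  qed
  then have "closed_manifold (Suc 0) G" "finite (verts G)"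
    using suspension_closed_manifold[OF 0] by auto
  then show ?case by (simp add: closed_manifold_iff sphere_1_iff)
next
  case (Suc n)
  note d = Suc.prems(1)
  let ?Q = "induced G (verts G - {u, w})"
  have rims: "sphere (Suc n) (rim G x)" if x: "x \<in> verts G - {u, w}" for x
  proof (rule Suc.IH)
    have uw: "u \<in> nbrs G x" "w \<in> nbrs G x"
      using Suc.prems(6)[OF x] by (simp_all add: mem_nbrs[OF d] adj_commute)
    then show "u \<in> verts (rim G x)" "w \<in> verts (rim G x)" by simp_all
    show "adj (rim G x) u z \<and> adj (rim G x) w z" if "z \<in> verts (rim G x) - {u, w}" for z
      using that Suc.prems(6)[of z] uw nbrs_subset[of G x] by auto
    have "closed_manifold (Suc n) ?Q" using sphere_closed_manifold[OF Suc.prems(7)] by simp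
    then have "sphere n (rim ?Q x)" using x by (simp add: closed_manifold_iff)
    moreover have "rim ?Q x = induced (rim G x) (verts (rim G x) - {u, w})"
      using d x by (intro dgraph_eqI) (auto simp: mem_nbrs adj_digital)
    ultimately show "sphere n (induced (rim G x) (verts (rim G x) - {u, w}))" by simp
  qed (use Suc.prems(1,4,5) in simp_all)
  note M = suspension_closed_manifold(1)[OF Suc.prems rims]
    and fin = suspension_closed_manifold(2)[OF Suc.prems rims]
  have cone: "disk (Suc (Suc n)) (delete_point G x) (nbrs G x)" and nb: "nbrs G x = verts G - {u, w}"
    if xy: "x = u \<and> y = w \<or> x = w \<and> y = u" for x y
  proof -
    have y: "y \<in> verts (delete_point G x)" using xy Suc.prems(2-4) by auto
    have apex: "adj (delete_point G x) y z" if "z \<in> verts (delete_point G x)" "z \<noteq> y" for z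
      using that xy Suc.prems(4) Suc.prems(6)[of z] d by auto
    have "contractible (delete_point G x)"
      using cone_contractible[OF _ _ y apex] fin d by simp
    then show "disk (Suc (Suc n)) (delete_point G x) (nbrs G x)"
      using manifold_bd_delete_point[OF M _ dconnected_cone[OF y apex]] xy Suc.prems(2,3)
      by (auto simp: disk_n_iff)
    show "nbrs G x = verts G - {u, w}"
      using xy suspension_nbrs[OF d Suc.prems(5,6)] by auto
  qed
  have i: "(verts G - {w}) \<inter> (verts G - {u}) = verts G - {u, w}" by blast
  show ?case
  proof (rule sphere_glued[of _ "verts G - {w}" "verts G - {u}"])
    show "glued G (verts G - {w}) (verts G - {u})"
      using Suc.prems by (auto simp: glued_def adj_commute)
    show "disk (Suc (Suc n)) (induced G (verts G - {w})) ((verts G - {w}) \<inter> (verts G - {u}))"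
      using cone[of w u] nb[of w u] i by (simp add: delete_point_def)
    show "disk (Suc (Suc n)) (induced G (verts G - {u})) ((verts G - {w}) \<inter> (verts G - {u}))"
      using cone[of u w] nb[of u w] i by (simp add: delete_point_def)
  qed
qed

section \<open>Minimal spheres\<close>

definition antipode :: "dgraph \<Rightarrow> nat \<Rightarrow> nat \<Rightarrow> bool" where
  "antipode G x y \<longleftrightarrow> x \<in> verts G \<and> y \<in> verts G \<and> x \<noteq> y \<and> \<not> adj G x y \<and>
     (\<forall>z\<in>verts G - {x, y}. adj G x z \<and> adj G y z)"

lemma antipode_commute: "antipode G x y \<longleftrightarrow> antipode G y x"
  unfolding antipode_def adj_commute[of G x y] insert_commute[of x y] by blast

lemma antipode_nbrs:
  assumes "digital_space G" "antipode G u w"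
  shows "nbrs G u = verts G - {u, w}" "nbrs G w = verts G - {u, w}"
  using suspension_nbrs[OF assms(1), of u w] assms(2) by (simp_all add: antipode_def)

lemma verts_join [simp]: "verts (join G H) = verts G \<union> verts H"
  by (simp add: join_def)

lemma adj_join [simp]:
  "adj (join G H) x y \<longleftrightarrow> adj G x y \<or> adj H x y \<or> x \<in> verts G \<and> y \<in> verts H \<or> y \<in> verts G \<and> x \<in> verts H"
  by (auto simp: join_def adj_def doubleton_eq_iff)

lemma digital_join:
  assumes "digital_space G" "digital_space H" "verts G \<inter> verts H = {}"
  shows "digital_space (join G H)"
proof -
  have "card {u, v} = 2" if "u \<in> verts G" "v \<in> verts H" for u v
  proof -
    have "u \<noteq> v" using that assms(3) by blast
    then show ?thesis by simp
  qed
  note cross = this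
  show ?thesis unfolding digital_space_def
  proof
    fix e assume "e \<in> edges (join G H)"
    then consider "e \<in> edges G" | "e \<in> edges H"
      | u v where "e = {u, v}" "u \<in> verts G" "v \<in> verts H"
      by (auto simp: join_def)
    then show "e \<subseteq> verts (join G H) \<and> card e = 2"
    proof cases
      case 1
      then show ?thesis using assms(1) by (simp add: digital_space_def le_supI1)
    next
      case 2
      then show ?thesis using assms(2) by (simp add: digital_space_def le_supI2)
    next
      case 3
      then show ?thesis using cross by simp
    qed
  qed
qed

lemma verts_min_sphere: "verts (min_sphere n) = {..<2 * n + 2}"
proof (induction n)
  case (Suc n)
  have "{..<2 * Suc n + 2} = insert (2 * n + 2) (insert (2 * n + 3) {..<2 * n + 2})" by auto
  with Suc show ?case by simp
qed auto

lemma digital_min_sphere: "digital_space (min_sphere n)"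
proof (induction n)
  case (Suc n)
  then show ?case unfolding min_sphere.simps
    by (intro digital_join) (auto simp: verts_min_sphere)
qed simp

lemma sphere_min_sphere: "sphere n (min_sphere n)"
proof (induction n)
  case 0
  show ?case by (simp add: sphere_0)
next
  case (Suc n)
  let ?u = "2 * n + 2" and ?w = "2 * n + 3"
  have v: "verts (min_sphere (Suc n)) - {?u, ?w} = verts (min_sphere n)"
    by (auto simp: verts_min_sphere)
  have nadj: "\<not> adj (min_sphere n) ?u x" for x
    using adj_digital(1)[OF digital_min_sphere, of n ?u x] by (auto simp: verts_min_sphere)
  have "induced (min_sphere (Suc n)) (verts (min_sphere n)) = min_sphere n"
  proof (rule dgraph_eqI)
    fix x y assume "x \<in> verts (induced (min_sphere (Suc n)) (verts (min_sphere n)))"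
      "y \<in> verts (induced (min_sphere (Suc n)) (verts (min_sphere n)))"
    then show "adj (induced (min_sphere (Suc n)) (verts (min_sphere n))) x y \<longleftrightarrow> adj (min_sphere n) x y"
      by (auto simp: verts_min_sphere)
  qed (use digital_min_sphere[of n] digital_min_sphere[of "Suc n"] in auto)
  with Suc have "sphere n (induced (min_sphere (Suc n)) (verts (min_sphere (Suc n)) - {?u, ?w}))"
    by (simp only: v)
  moreover have "\<not> adj (min_sphere (Suc n)) ?u ?w"
    using nadj by (auto simp: verts_min_sphere)
  moreover have "adj (min_sphere (Suc n)) ?u x \<and> adj (min_sphere (Suc n)) ?w x"
    if "x \<in> verts (min_sphere (Suc n)) - {?u, ?w}" for x
    using that unfolding v by simp
  moreover have "?u \<in> verts (min_sphere (Suc n))" "?w \<in> verts (min_sphere (Suc n))"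
    unfolding verts_min_sphere by simp_all
  ultimately show ?case
    by (intro sphere_suspension[of _ ?u ?w]) (auto simp: digital_min_sphere simp del: min_sphere.simps)
qed

lemma antipodal_sphere_isomorphic:
  assumes "sphere n G" "\<And>x. x \<in> verts G \<Longrightarrow> \<exists>y. antipode G x y"
  shows "isomorphic G (min_sphere n)"
  using assms
proof (induction n arbitrary: G)
  case 0
  have d: "digital_space G" using 0(1) by (rule sphere_digital)
  obtain a b where ab: "a \<noteq> b" "verts G = {a, b}" "\<not> adj G a b"
    using 0(1) by (auto simp: sphere_0_iff)
  then have "\<not> adj G b a" by (simp add: adj_commute)
  with ab d have "graph_iso (\<lambda>x. if x = a then 0 else 1) G (S0 0 1)"
    by (auto simp: graph_iso_def bij_betw_def)
  then show ?case by (auto simp: isomorphic_def)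
next
  case (Suc n)
  have d: "digital_space G" using Suc.prems(1) by (rule sphere_digital)
  obtain u where u: "u \<in> verts G" using sphere_nonempty[OF Suc.prems(1)] by blast
  obtain w where uw: "antipode G u w" using Suc.prems(2)[OF u] by blast
  note nb = antipode_nbrs[OF d uw]
  have w: "w \<in> verts G" "u \<noteq> w" "\<not> adj G u w" "\<not> adj G w u"
    using uw by (auto simp: antipode_def adj_commute)
  let ?R = "rim G u"
  have "sphere n ?R" using sphere_closed_manifold[OF Suc.prems(1)] u by (simp add: closed_manifold_iff)
  moreover have "\<exists>y. antipode ?R x y" if "x \<in> verts ?R" for x
  proof -
    from that have x: "x \<in> verts G - {u, w}" using nb by simp
    then obtain y where y: "antipode G x y" using Suc.prems(2) by blast
    have "adj G x u" "adj G x w"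
      using x nb mem_nbrs[OF d, of x u] mem_nbrs[OF d, of x w] by (auto simp: adj_commute)
    then have "y \<noteq> u" "y \<noteq> w" using y by (auto simp: antipode_def)
    then have "antipode ?R x y" using x y nb by (auto simp: antipode_def)
    then show ?thesis ..
  qed
  ultimately have "isomorphic ?R (min_sphere n)" by (rule Suc.IH)
  then obtain f where f: "graph_iso f ?R (min_sphere n)" by (auto simp: isomorphic_def)
  let ?a = "2 * n + 2" and ?b = "2 * n + 3"
  define g where "g x = (if x = u then ?a else if x = w then ?b else f x)" for x
  note fD = graph_isoD[OF f]
  have fV: "f x < ?a" if "x \<in> verts G - {u, w}" for x
    using fD(5)[of x] that nb by (simp add: verts_min_sphere)
  have g: "g u = ?a" "g w = ?b" "\<And>x. x \<in> verts G - {u, w} \<Longrightarrow> g x = f x"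
    using w by (auto simp: g_def)
  have "bij_betw g (verts G - {u, w}) {..<?a}"
    using fD(1) nb g(3) bij_betw_cong[of "verts G - {u, w}" g f] by (simp add: verts_min_sphere)
  moreover have "bij_betw g {u, w} {?a, ?b}" using g w(2) by (auto simp: bij_betw_def)
  ultimately have "bij_betw g ((verts G - {u, w}) \<union> {u, w}) ({..<?a} \<union> {?a, ?b})"
    by (rule bij_betw_combine) auto
  moreover have "(verts G - {u, w}) \<union> {u, w} = verts G" using u w by blast
  moreover have "{..<?a} \<union> {?a, ?b} = verts (min_sphere (Suc n))" by (auto simp: verts_min_sphere)
  ultimately have bij: "bij_betw g (verts G) (verts (min_sphere (Suc n)))" by simp
  have nadj: "\<not> adj (min_sphere n) ?a x" "\<not> adj (min_sphere n) ?b x"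
    "\<not> adj (min_sphere n) x ?a" "\<not> adj (min_sphere n) x ?b" for x
    using adj_digital(1)[OF digital_min_sphere, of n ?a x] adj_digital(2)[OF digital_min_sphere, of n x ?a]
      adj_digital(1)[OF digital_min_sphere, of n ?b x] adj_digital(2)[OF digital_min_sphere, of n x ?b]
    by (auto simp: verts_min_sphere)
  have adj: "adj G x y \<longleftrightarrow> adj (min_sphere (Suc n)) (g x) (g y)"
    if xy: "x \<in> verts G" "y \<in> verts G" for x y
  proof -
    have au: "adj G u z" "adj G z u" "adj G w z" "adj G z w" if "z \<in> verts G - {u, w}" for z
      using that nb mem_nbrs[OF d, of z u] mem_nbrs[OF d, of z w] by (auto simp: adj_commute)
    consider "x \<in> {u, w}" "y \<in> {u, w}" | "x \<in> {u, w}" "y \<in> verts G - {u, w}"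
      | "y \<in> {u, w}" "x \<in> verts G - {u, w}" | "x \<in> verts G - {u, w}" "y \<in> verts G - {u, w}"
      using xy by blast
    then show ?thesis
    proof cases
      case 1
      then show ?thesis using g(1,2) w(3,4) nadj d by (auto simp: verts_min_sphere)
    next
      case 2
      then show ?thesis using g au[of y] fV[of y] by (auto simp: verts_min_sphere)
    next
      case 3
      then show ?thesis using g au[of x] fV[of x] by (auto simp: verts_min_sphere)
    next
      case 4
      then show ?thesis using g(3) fD(4)[of x y] fV[of x] fV[of y] nb by (simp add: verts_min_sphere)
    qed
  qed
  from bij adj have "graph_iso g G (min_sphere (Suc n))" by (simp add: graph_iso_def)
  then show ?case by (auto simp: isomorphic_def)
qed

section \<open>Shrinking the complement of a point\<close>

lemma shrink_punctured_sphere: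
  assumes S: "sphere n G" "n \<ge> 1" and u: "u \<in> verts G"
  obtains H w where "h_transformation n G H" "sphere n H" "w \<notin> verts G"
    "verts H = insert w (insert u (nbrs G u))" "antipode H u w"
    "\<And>x y. x \<in> verts G \<Longrightarrow> y \<in> verts G \<Longrightarrow> x \<in> verts H \<Longrightarrow> y \<in> verts H \<Longrightarrow> adj H x y \<longleftrightarrow> adj G x y"
proof -
  have d: "digital_space G" using S(1) by (rule sphere_digital)
  obtain w where w: "w \<notin> verts G"
    using sphere_finite[OF S(1)] ex_new_if_finite infinite_UNIV_nat by metis
  let ?B = "nbrs G u" and ?W = "verts G - {u}"
  define H where "H = induced (add_point G w ?B) (insert w (verts G) - (?W - ?B))"
  have h: "h_transformation n G H"
    unfolding H_def using sphere_closed_manifold[OF S] sphere_delete_point[OF S(1) u] w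
    by (intro shrink_disk) (auto simp: delete_point_def)
  have dH: "digital_space H" using d w nbrs_subset by (simp add: H_def)
  have vH: "verts H = insert w (insert u ?B)"
    using u w nbrs_subset[of G u] by (auto simp: H_def)
  have "w \<noteq> u" "w \<notin> ?B" "u \<notin> ?B" using u w d nbrs_subset by auto
  have adj: "adj H x y \<longleftrightarrow> adj G x y" if "x \<in> verts G" "y \<in> verts G" "x \<in> verts H" "y \<in> verts H" for x y
    using that w by (auto simp: H_def)
  have nw: "\<not> adj G w x" "\<not> adj G x w" for x using adj_digital[OF d] w by blast+
  have anti: "antipode H u w"
    using \<open>w \<noteq> u\<close> \<open>w \<notin> ?B\<close> \<open>u \<notin> ?B\<close> vH u w nw nbrs_subset[of G u] mem_nbrs[OF d, of _ u]
    by (auto simp: antipode_def H_def)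
  have "verts H - {u, w} = ?B" using vH \<open>w \<noteq> u\<close> \<open>w \<notin> ?B\<close> \<open>u \<notin> ?B\<close> by auto
  moreover have "induced H ?B = rim G u"
  proof (rule dgraph_eqI)
    show "verts (induced H ?B) = verts (rim G u)" using vH by auto
    show "adj (induced H ?B) x y \<longleftrightarrow> adj (rim G u) x y"
      if "x \<in> verts (induced H ?B)" "y \<in> verts (induced H ?B)" for x y
      using that adj[of x y] nbrs_subset[of G u] by auto
  qed (use d dH in auto)
  moreover have "sphere (n - 1) (rim G u)"
    using sphere_closed_manifold[OF S] u by (simp add: closed_manifold_iff)
  ultimately have "sphere (Suc (n - 1)) H"
    using anti by (intro sphere_suspension[OF dH, of u w]) (auto simp: antipode_def)
  with S(2) have "sphere n H" by simp
  from that[OF h this w vH anti adj] show thesis .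
qed

lemma sphere_h_reachable:
  assumes "sphere n G" "n \<ge> 1"
  shows "h_reachable n G (min_sphere n)"
  using assms(1)
proof (induction "card {x \<in> verts G. \<nexists>y. antipode G x y}" arbitrary: G rule: less_induct)
  case less
  let ?bad = "\<lambda>G. {x \<in> verts G. \<nexists>y. antipode G x y}"
  show ?case
  proof (cases "?bad G = {}")
    case True
    then have "isomorphic G (min_sphere n)"
      using antipodal_sphere_isomorphic[OF less.prems] by blast
    then show ?thesis by (auto simp: h_reachable_def)
  next
    case False
    then obtain u where u: "u \<in> verts G" "\<And>y. \<not> antipode G u y" by blast
    have d: "digital_space G" using less.prems by (rule sphere_digital)
    obtain H w where H: "h_transformation n G H" "sphere n H" "w \<notin> verts G"
      "verts H = insert w (insert u (nbrs G u))" "antipode H u w"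
      and adjH: "\<And>x y. x \<in> verts G \<Longrightarrow> y \<in> verts G \<Longrightarrow> x \<in> verts H \<Longrightarrow> y \<in> verts H \<Longrightarrow> adj H x y \<longleftrightarrow> adj G x y"
      using shrink_punctured_sphere[OF less.prems assms(2) u(1)] by metis
    have dH: "digital_space H" using H(2) by (rule sphere_digital)
    have keep: "antipode H x y" if xy: "antipode G x y" for x y
    proof -
      have ne: "x \<noteq> u" "y \<noteq> u" using u(2) xy antipode_commute by blast+
      then have "adj G x u" "adj G y u" using xy u(1) by (auto simp: antipode_def)
      then have nb: "x \<in> nbrs G u" "y \<in> nbrs G u" using d by (auto simp: mem_nbrs adj_commute)
      have v: "x \<in> verts G" "y \<in> verts G" "x \<noteq> y" "\<not> adj G x y" "x \<in> verts H" "y \<in> verts H"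
        using xy nb H(4) by (auto simp: antipode_def)
      have "adj H x z \<and> adj H y z" if z: "z \<in> verts H - {x, y}" for z
      proof (cases "z = w")
        case True
        have "nbrs H w = verts H - {u, w}" using antipode_nbrs[OF dH H(5)] by simp
        moreover have "x \<noteq> w" "y \<noteq> w" using v H(3) by auto
        ultimately have "x \<in> nbrs H w" "y \<in> nbrs H w" using v ne by simp_all
        then show ?thesis using True by (simp add: mem_nbrs[OF dH] adj_commute)
      next
        case False
        then have "z \<in> verts G" using z H(4) u(1) nbrs_subset[of G u] by blast
        then show ?thesis
          using xy z v adjH[of x z] adjH[of y z] by (simp add: antipode_def)
      qed
      then show ?thesis using v adjH[of x y] by (simp add: antipode_def)
    qed
    have "antipode H w u" using H(5) by (simp add: antipode_commute)
    have "?bad H \<subseteq> ?bad G - {u}"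
    proof
      fix x assume x: "x \<in> ?bad H"
      then have "x \<noteq> u" "x \<noteq> w" using H(5) \<open>antipode H w u\<close> by auto
      with x have "x \<in> verts G" using H(4) nbrs_subset[of G u] by auto
      with x keep[of x] \<open>x \<noteq> u\<close> show "x \<in> ?bad G - {u}" by auto
    qed
    then have "card (?bad H) < card (?bad G)"
      using u sphere_finite[OF less.prems] by (intro psubset_card_mono) auto
    then have "h_reachable n H (min_sphere n)" using less.hyps H(2) by blast
    then show ?thesis unfolding h_reachable_def
      using H(1) by (blast intro: converse_rtranclp_into_rtranclp)
  qed
qed

theorem lemma4p3:
  fixes n :: nat and S :: dgraph
  assumes "n \<ge> 1" and "sphere n S"
  shows "homeomorphic n S (min_sphere n)"
  using sphere_h_reachable[OF assms(2,1)] sphere_closed_manifold[OF assms(2,1)]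
    sphere_closed_manifold[OF sphere_min_sphere assms(1)]
  by (simp add: homeomorphic_def)

end
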